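(* Let $\Bbbk$ be a countable totally ordered division ring. Then every completely normal distributive $0$-lattice $L$ with at most $\aleph_1$ elements is a surjective homomorphic image of $\mathrm{Id}_c F$ for some vector lattice $F$ over $\Bbbk$; that is, there exist a vector lattice $F$ over $\Bbbk$ and a surjective lattice homomorphism $\mathrm{Id}_c F\twoheadrightarrow L$.
   Context: A totally ordered division ring is a division ring with a total order such that $x\le y$ implies $x+z\le y+z$, and $0\le x,y$ implies $0\le xy$. A (left) vector lattice over $\Bbbk$ is a left $\Bbbk$-vector space $F$ endowed with a lattice order making it a lattice-ordered group such that $\lambda x\ge 0$ whenever $\lambda\ge 0$ in $\Bbbk$ and $x\ge0$ in $F$. An $\ell$-ideal of $F$ is an order-convex $\Bbbk$-vector subspace of $F$ closed under the lattice operations; $\mathrm{Id}_c F$ denotes the lattice, under inclusion, of all principal $\ell$-ideals of $F$, i.e. the sets $\langle a\rangle=\{x\in F: |x|\le \lambda a\text{ for some }\lambda\in\Bbbk\}$ for $a\ge 0$ (the $\ell$-ideal generated by $a$). A distributive $0$-lattice $D$ (distributive lattice with least element $0$) is completely normal if for all $a,b\in D$ there exist $x,y\in D$ with $a\vee b=a\vee y=x\vee b$ and $x\wedge y=0$. *)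

theory Defs
  imports "HOL-Algebra.Module" "HOL-Algebra.Lattice" "HOL-Library.Countable_Set"
begin

unbundle cardinal_syntax

text \<open>
  The scalars form a type of sort \<open>{division_ring, linordered_ring}\<close>, that is, a totally ordered
  division ring, not assumed commutative. The record fields for multiplication and unit, inherited
  from rings via \<^typ>\<open>('k, 'v) module\<close>, are unused, as for modules in HOL-Algebra.
\<close>

record ('k, 'v) ordered_module = "('k, 'v) module" +
  vle :: "['v, 'v] \<Rightarrow> bool" (infixl \<open>\<preceq>\<index>\<close> 50)

definition vorder :: "('k, 'v, 'm) ordered_module_scheme \<Rightarrow> 'v gorder"
  where "vorder F = \<lparr>carrier = carrier F, eq = (=), le = vle F\<rparr>"

locale vector_lattice = abelian_group F + ord: Lattice.lattice "vorder F"
  for F :: "('k :: {division_ring, linordered_ring}, 'v, 'm) ordered_module_scheme" (structure) +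
  assumes smult_closed: "x \<in> carrier F \<Longrightarrow> c \<odot> x \<in> carrier F"
    and smult_one: "x \<in> carrier F \<Longrightarrow> 1 \<odot> x = x"
    and smult_assoc: "x \<in> carrier F \<Longrightarrow> (c * d) \<odot> x = c \<odot> (d \<odot> x)"
    and smult_l_distr: "x \<in> carrier F \<Longrightarrow> (c + d) \<odot> x = c \<odot> x \<oplus> d \<odot> x"
    and smult_r_distr: "\<lbrakk>x \<in> carrier F; y \<in> carrier F\<rbrakk> \<Longrightarrow> c \<odot> (x \<oplus> y) = c \<odot> x \<oplus> c \<odot> y"
    and add_mono: "\<lbrakk>x \<in> carrier F; y \<in> carrier F; z \<in> carrier F; x \<preceq> y\<rbrakk> \<Longrightarrow> x \<oplus> z \<preceq> y \<oplus> z"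
    and smult_nonneg: "\<lbrakk>x \<in> carrier F; 0 \<le> c; \<zero> \<preceq> x\<rbrakk> \<Longrightarrow> \<zero> \<preceq> c \<odot> x"

definition vabs :: "('k, 'v, 'm) ordered_module_scheme \<Rightarrow> 'v \<Rightarrow> 'v"
  where "vabs F x = x \<squnion>\<^bsub>vorder F\<^esub> (\<ominus>\<^bsub>F\<^esub> x)"

definition principal_ideal :: "('k, 'v, 'm) ordered_module_scheme \<Rightarrow> 'v \<Rightarrow> 'v set"
  where "principal_ideal F a = {x \<in> carrier F. \<exists>c. vabs F x \<preceq>\<^bsub>F\<^esub> c \<odot>\<^bsub>F\<^esub> a}"

definition Idc :: "('k, 'v, 'm) ordered_module_scheme \<Rightarrow> 'v set gorder"
  where "Idc F = \<lparr>carrier = {principal_ideal F a |a. a \<in> carrier F \<and> \<zero>\<^bsub>F\<^esub> \<preceq>\<^bsub>F\<^esub> a},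
                  eq = (=), le = (\<subseteq>)\<rparr>"

text \<open>
  HOL-Algebra hides the constants of the type class \<^class>\<open>lattice\<close>, hence the qualified names below.
\<close>

definition lattice_hom :: "('a, 'm) gorder_scheme \<Rightarrow> ('a \<Rightarrow> 'l :: lattice) \<Rightarrow> bool"
  where "lattice_hom A h \<longleftrightarrow> Lattice.lattice A \<and>
    (\<forall>x \<in> carrier A. \<forall>y \<in> carrier A.
      h (x \<squnion>\<^bsub>A\<^esub> y) = sup_class.sup (h x) (h y) \<and> h (x \<sqinter>\<^bsub>A\<^esub> y) = inf_class.inf (h x) (h y))"

definition completely_normal :: "'l :: {distrib_lattice, bounded_lattice_bot} itself \<Rightarrow> bool"
  where "completely_normal _ \<longleftrightarrow>
    (\<forall>a b :: 'l. \<exists>x y. sup_class.sup a b = sup_class.sup a y \<and>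
                       sup_class.sup a b = sup_class.sup x b \<and> inf_class.inf x y = bot)"

text \<open>
  HOL cannot quantify existentially over types, so the carrier of the vector lattice \<open>F\<close> is a subset
  of a fixed type. The following type is large enough for this to be no restriction. Let
  \<open>h : Idc F \<rightarrow> L\<close> be a surjective homomorphism for a vector lattice \<open>F\<close> on any type, with countable
  scalars, and let \<open>F'\<close> be the vector sublattice generated by a choice, for each \<open>l \<in> L\<close>,
  of some \<open>a \<ge> 0\<close> with \<open>h \<langle>a\<rangle> = l\<close>. Then \<open>\<langle>a\<rangle> \<mapsto> \<langle>a\<rangle>\<close> is a lattice homomorphism
  \<open>Idc F' \<rightarrow> Idc F\<close> whose composite with \<open>h\<close> is still surjective, and \<open>F'\<close> has at most
  \<open>|L| + \<aleph>\<^sub>0\<close> elements, so it can be copied into this type.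
\<close>

type_synonym ('k, 'l) vl_universe = "('l \<times> nat \<Rightarrow> 'k) \<Rightarrow> 'k"

end

theory Submission
  imports Defs "HOL-Library.Function_Algebras" "HOL-Library.Countable_Set_Type"
begin

text \<open>
  A surjection \<open>Idc F \<rightarrow> L\<close> amounts to a vector space \<open>E\<close> with a family of total preorderings, one for each
  prime filter of \<open>L\<close>, such that for every \<open>x \<in> E\<close> the prime filters at which \<open>x > 0\<close> are those
  containing some \<open>\<phi> x \<in> L\<close>. On the space with basis \<open>L\<close> such a map \<open>\<phi>\<close> with \<open>\<phi> l = l\<close> for every basis
  vector \<open>l\<close> is built by transfinite recursion along a well-ordering of \<open>L\<close> with countable initial
  segments. To adjoin a vector \<open>t\<close>, one chooses the elements of \<open>L\<close> where \<open>t > x\<close> and where \<open>t < x\<close>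
  for one \<open>x\<close> of a countable space at a time. Each choice is subject to finitely many conditions,
  which complete normality makes solvable.
\<close>

text \<open>Two obstacles shape the proof. \<open>L\<close> has finite meets only, so a new vector
  \<open>t\<close> cannot be compared with infinitely many old vectors at once. Comparing it with
  one after another leaves finitely many conditions each time, but reaches all old vectors only if
  these form a countable set. This is where both countability of the scalars and the bound
  \<open>cardSuc natLeq\<close> enter. Secondly, the values of \<open>t > x\<close> and
  \<open>t < x\<close> are disjoint but need not be complementary, since \<open>t\<close> and
  \<open>x\<close> may tie at a prime filter. Both values must therefore be carried along, and
  keeping them disjoint is the task of complete normality. The first comparison, with
  \<open>x = 0\<close>, is subject to disjointness alone, so the value of \<open>t > 0\<close> may
  be any element of \<open>L\<close>. Surjectivity comes from this freedom. The vector lattice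
  consists of functions from sets of elements of \<open>L\<close> to the vector space, obtained from
  constants by pointwise maxima and minima. Ties are broken in order to have true total orders.
  Principal ideals then see more than \<phi> does, so the map onto \<open>L\<close> is in general
  not injective.\<close>

notation sup_class.sup (infixl \<open>\<curlyvee>\<close> 65)
notation inf_class.inf (infixl \<open>\<curlywedge>\<close> 70)

section \<open>Totally ordered division rings\<close>

lemma ordered_division_ring_mult_pos:
  fixes a b :: "'k :: {division_ring, linordered_ring}"
  assumes "0 < a" "0 < b"
  shows "0 < a * b"
  using assms mult_nonneg_nonneg[of a b] by (simp add: less_le)

lemma ordered_division_ring_zero_less_one: "0 < (1 :: 'k :: {division_ring, linordered_ring})"
  using zero_le_square[of "1 :: 'k"] by (simp add: less_le)

lemma ordered_division_ring_inverse_pos: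
  fixes a :: "'k :: {division_ring, linordered_ring}"
  assumes "0 < a"
  shows "0 < inverse a"
proof (rule ccontr)
  assume "\<not> 0 < inverse a"
  moreover have "inverse a \<noteq> 0" using assms by simp
  ultimately have "inverse a < 0" by (simp add: not_less less_le)
  then have "0 < a * (- inverse a)"
    using assms by (intro ordered_division_ring_mult_pos) auto
  then show False
    using assms ordered_division_ring_zero_less_one[where 'k = 'k] by simp
qed

section \<open>Distributive lattices\<close>

text \<open>This is the cut rule of sequent calculus, with \<open>c\<close> as the cut
  formula.\<close>

lemma distrib_lattice_cut:
  fixes a b c :: "'l :: distrib_lattice"
  assumes "a \<le> b \<curlyvee> c" "a \<curlywedge> c \<le> b"
  shows "a \<le> b"
proof -
  have "a = a \<curlywedge> (b \<curlyvee> c)" using assms(1) by (simp add: inf_absorb1)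
  also have "\<dots> = (a \<curlywedge> b) \<curlyvee> (a \<curlywedge> c)" by (rule inf_sup_distrib1)
  also have "\<dots> \<le> b" using assms(2) by simp
  finally show ?thesis .
qed

text \<open>The element \<open>m\<close> is the meet of the values of \<open>g\<close>; without a
  top element the index set has to be nonempty. The universal property carries a side term
  \<open>w\<close>, which distributivity permits, because the bounds met later hold only up to a
  join with another value.\<close>

lemma finite_meet_exists:
  fixes g :: "'i \<Rightarrow> 'l :: distrib_lattice"
  assumes "finite A" "A \<noteq> {}"
  shows "\<exists>m. (\<forall>i\<in>A. m \<le> g i) \<and> (\<forall>s w. (\<forall>i\<in>A. s \<le> g i \<curlyvee> w) \<longrightarrow> s \<le> m \<curlyvee> w)"
  using assms
proof (induction A rule: finite_ne_induct)
  case (singleton i)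
  then show ?case by auto
next
  case (insert i A)
  then obtain m where m: "\<forall>j\<in>A. m \<le> g j" "\<And>s w. (\<forall>j\<in>A. s \<le> g j \<curlyvee> w) \<Longrightarrow> s \<le> m \<curlyvee> w"
    by blast
  have "s \<le> g i \<curlywedge> m \<curlyvee> w" if "\<forall>j\<in>insert i A. s \<le> g j \<curlyvee> w" for s w
    using that m(2)[of s w] by (simp add: sup_inf_distrib2)
  with m(1) show ?case
    by (intro exI[of _ "g i \<curlywedge> m"]) (auto intro: le_infI1 le_infI2)
qed

text \<open>The empty set and the whole lattice qualify. The latter is excluded later by
  \<open>proper_prime\<close>; the former does no harm.\<close>

definition prime_filter :: "'l :: lattice set \<Rightarrow> bool"
  where "prime_filter P \<longleftrightarrow> (\<forall>a b. a \<curlywedge> b \<in> P \<longleftrightarrow> a \<in> P \<and> b \<in> P) \<and>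
    (\<forall>a b. a \<curlyvee> b \<in> P \<longleftrightarrow> a \<in> P \<or> b \<in> P)"

lemma prime_filter_mono: "\<lbrakk>prime_filter P; a \<in> P; a \<le> b\<rbrakk> \<Longrightarrow> b \<in> P"
  unfolding prime_filter_def by (metis inf_absorb1)

text \<open>A filter that is maximal among those containing \<open>a\<close> and omitting
  \<open>b\<close> is prime by distributivity. Prime filters thus separate elements, so an
  inequality in \<open>L\<close> may be tested at prime filters.\<close>

lemma prime_filter_exists:
  fixes a b :: "'l :: distrib_lattice"
  assumes "\<not> a \<le> b"
  shows "\<exists>P. prime_filter P \<and> a \<in> P \<and> b \<notin> P"
proof -
  define meet_closed where "meet_closed P \<longleftrightarrow> (\<forall>x\<in>P. \<forall>y\<in>P. x \<curlywedge> y \<in> P)" for P :: "'l set"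
  define up_closed where "up_closed P \<longleftrightarrow> (\<forall>x\<in>P. \<forall>y. x \<le> y \<longrightarrow> y \<in> P)" for P :: "'l set"
  define \<F> where "\<F> = {P. meet_closed P \<and> up_closed P \<and> a \<in> P \<and> b \<notin> P}"
  have \<F>I: "P \<in> \<F>" if "meet_closed P" "up_closed P" "a \<in> P" "b \<notin> P" for P
    using that by (simp add: \<F>_def)
  have \<F>D: "meet_closed P" "up_closed P" "a \<in> P" "b \<notin> P" if "P \<in> \<F>" for P
    using that by (simp_all add: \<F>_def)
  have "{x. a \<le> x} \<in> \<F>"
    using assms by (intro \<F>I) (auto simp: meet_closed_def up_closed_def)
  then have "\<F> \<noteq> {}" by auto
  moreover have "\<Union>\<C> \<in> \<F>" if "\<C> \<noteq> {}" and chain: "subset.chain \<F> \<C>" for \<C>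
  proof (rule \<F>I)
    have sub: "P \<in> \<F>" if "P \<in> \<C>" for P
      using chain that by (auto simp: subset.chain_def)
    show "meet_closed (\<Union>\<C>)"
      unfolding meet_closed_def
    proof (intro ballI)
      fix x y assume "x \<in> \<Union>\<C>" "y \<in> \<Union>\<C>"
      then obtain P Q where PQ: "P \<in> \<C>" "Q \<in> \<C>" "x \<in> P" "y \<in> Q" by (elim UnionE)
      from chain PQ(1,2) have "P \<subseteq> Q \<or> Q \<subseteq> P" by (auto simp: subset.chain_def)
      then obtain R where "R \<in> \<C>" "x \<in> R" "y \<in> R" using PQ by (elim disjE) auto
      with \<F>D(1)[OF sub[of R]] show "x \<curlywedge> y \<in> \<Union>\<C>" by (auto simp: meet_closed_def)
    qed
    show "up_closed (\<Union>\<C>)"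
      unfolding up_closed_def
    proof (intro ballI allI impI)
      fix x y assume "x \<in> \<Union>\<C>" "x \<le> y"
      then obtain R where "R \<in> \<C>" "x \<in> R" by (elim UnionE)
      with \<F>D(2)[OF sub[of R]] \<open>x \<le> y\<close> show "y \<in> \<Union>\<C>" by (auto simp: up_closed_def)
    qed
    show "a \<in> \<Union>\<C>" using \<open>\<C> \<noteq> {}\<close> \<F>D(3)[OF sub] by auto
    show "b \<notin> \<Union>\<C>" using \<F>D(4)[OF sub] by auto
  qed
  ultimately have "\<exists>P\<in>\<F>. \<forall>Q\<in>\<F>. P \<subseteq> Q \<longrightarrow> Q = P" by (rule subset_Zorn_nonempty)
  then obtain P where P: "P \<in> \<F>" and max: "\<And>Q. Q \<in> \<F> \<Longrightarrow> P \<subseteq> Q \<Longrightarrow> Q = P"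
    by blast
  have meet: "x \<curlywedge> y \<in> P" if "x \<in> P" "y \<in> P" for x y
    using \<F>D(1)[OF P] that by (simp add: meet_closed_def)
  have up: "y \<in> P" if "x \<in> P" "x \<le> y" for x y
    using \<F>D(2)[OF P] that by (simp add: up_closed_def)
  \<comment> \<open>By maximality, the filter generated by \<open>P\<close> and \<open>x\<close>
    cannot omit \<open>b\<close>.\<close>
  have split: "\<exists>p\<in>P. p \<curlywedge> x \<le> b" if "x \<notin> P" for x
  proof (rule ccontr)
    assume none: "\<not> ?thesis"
    let ?Q = "{y. \<exists>p\<in>P. p \<curlywedge> x \<le> y}"
    have "?Q \<in> \<F>"
    proof (rule \<F>I)
      show "meet_closed ?Q"
        unfolding meet_closed_def
      proof (intro ballI)
        fix y z assume "y \<in> ?Q" "z \<in> ?Q"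
        then obtain p q where pq: "p \<in> P" "q \<in> P" "p \<curlywedge> x \<le> y" "q \<curlywedge> x \<le> z" by auto
        have "(p \<curlywedge> q) \<curlywedge> x \<le> p \<curlywedge> x" "(p \<curlywedge> q) \<curlywedge> x \<le> q \<curlywedge> x"
          by (intro inf_mono inf_le1 inf_le2 order_refl)+
        with pq(3,4) have "(p \<curlywedge> q) \<curlywedge> x \<le> y \<curlywedge> z"
          by (intro le_infI) (rule order_trans, assumption+)+
        with meet[OF pq(1,2)] show "y \<curlywedge> z \<in> ?Q" by blast
      qed
      show "up_closed ?Q"
        unfolding up_closed_def using order_trans by blast
      show "a \<in> ?Q" using \<F>D(3)[OF P] by (auto intro!: bexI[of _ a])
      show "b \<notin> ?Q" using none by simp
    qed
    moreover have "P \<subseteq> ?Q" using inf_le1 by blast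
    ultimately have "?Q = P" by (rule max)
    moreover have "x \<in> ?Q" using \<F>D(3)[OF P] by (auto intro!: bexI[of _ a])
    ultimately show False using that by simp
  qed
  have prime: "x \<in> P \<or> y \<in> P" if "x \<curlyvee> y \<in> P" for x y
  proof (rule ccontr)
    assume "\<not> ?thesis"
    then obtain p q where pq: "p \<in> P" "q \<in> P" "p \<curlywedge> x \<le> b" "q \<curlywedge> y \<le> b"
      using split[of x] split[of y] by auto
    have "(p \<curlywedge> q) \<curlywedge> x \<le> p \<curlywedge> x" "(p \<curlywedge> q) \<curlywedge> y \<le> q \<curlywedge> y"
      by (intro inf_mono inf_le1 inf_le2 order_refl)+
    with pq(3,4) have "(p \<curlywedge> q) \<curlywedge> (x \<curlyvee> y) \<le> b"
      unfolding inf_sup_distrib1 by (intro le_supI) (rule order_trans, assumption+)+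
    with meet[OF meet[OF pq(1,2)] that] have "b \<in> P" by (rule up)
    with \<F>D(4)[OF P] show False by simp
  qed
  have "prime_filter P"
    unfolding prime_filter_def using meet prime up inf_le1 inf_le2 sup_ge1 sup_ge2 by meson
  with \<F>D(3,4)[OF P] show ?thesis by (intro exI[of _ P]) simp
qed

section \<open>Lattice-valued orderings\<close>

definition scale :: "'k :: times \<Rightarrow> ('i \<Rightarrow> 'k) \<Rightarrow> 'i \<Rightarrow> 'k" (infixr \<open>*\<^sub>V\<close> 75)
  where "c *\<^sub>V x = (\<lambda>i. c * x i)"

lemma scale_apply [simp]: "(c *\<^sub>V x) i = c * x i"
  by (simp add: scale_def)

definition unit_vec :: "'i \<Rightarrow> 'i \<Rightarrow> 'k :: zero_neq_one"
  where "unit_vec l = (\<lambda>i. if i = l then 1 else 0)"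

definition lin_subspace :: "('i \<Rightarrow> 'k :: ring) set \<Rightarrow> bool"
  where "lin_subspace S \<longleftrightarrow> 0 \<in> S \<and> (\<forall>x\<in>S. \<forall>y\<in>S. x + y \<in> S) \<and> (\<forall>x\<in>S. \<forall>c. c *\<^sub>V x \<in> S)"

lemma lin_subspace_uminus: "\<lbrakk>lin_subspace S; x \<in> S\<rbrakk> \<Longrightarrow> - x \<in> S"
  for S :: "('i \<Rightarrow> 'k :: ring_1) set"
proof -
  assume "lin_subspace S" "x \<in> S"
  moreover have "- x = (- 1) *\<^sub>V x" by (auto simp: fun_eq_iff)
  ultimately show ?thesis by (simp add: lin_subspace_def)
qed

lemma lin_subspace_diff: "\<lbrakk>lin_subspace S; x \<in> S; y \<in> S\<rbrakk> \<Longrightarrow> x - y \<in> S"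
  for S :: "('i \<Rightarrow> 'k :: ring_1) set"
  using lin_subspace_uminus[of S y] unfolding lin_subspace_def diff_conv_add_uminus by blast

text \<open>
  Read \<open>\<phi> x\<close> as the truth value of \<open>x > 0\<close>: for every prime filter \<open>P\<close>, the set of all \<open>x\<close> with
  \<open>\<phi> (- x) \<notin> P\<close> is the nonnegative cone of a total preordering of the vector space \<open>S\<close>.
\<close>

definition valued_order ::
    "('i \<Rightarrow> 'k :: {division_ring, linordered_ring}) set \<Rightarrow>
     (('i \<Rightarrow> 'k) \<Rightarrow> 'l :: {distrib_lattice, bounded_lattice_bot}) \<Rightarrow> bool"
  where "valued_order S \<phi> \<longleftrightarrow>
    (\<forall>x\<in>S. \<forall>c>0. \<phi> (c *\<^sub>V x) = \<phi> x) \<and> (\<forall>x\<in>S. \<phi> x \<curlywedge> \<phi> (- x) = bot) \<and>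
    (\<forall>x\<in>S. \<forall>y\<in>S. \<phi> (x + y) \<le> \<phi> x \<curlyvee> \<phi> y)"

lemma valued_order_scale: "\<lbrakk>valued_order S \<phi>; x \<in> S; 0 < c\<rbrakk> \<Longrightarrow> \<phi> (c *\<^sub>V x) = \<phi> x"
  by (simp add: valued_order_def)

lemma valued_order_disjoint: "\<lbrakk>valued_order S \<phi>; x \<in> S\<rbrakk> \<Longrightarrow> \<phi> x \<curlywedge> \<phi> (- x) = bot"
  by (simp add: valued_order_def)

lemma valued_order_add: "\<lbrakk>valued_order S \<phi>; x \<in> S; y \<in> S\<rbrakk> \<Longrightarrow> \<phi> (x + y) \<le> \<phi> x \<curlyvee> \<phi> y"
  by (simp add: valued_order_def)

lemma valued_order_zero:
  assumes "valued_order S \<phi>" "lin_subspace S"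
  shows "\<phi> 0 = bot"
proof -
  have "0 \<in> S" using assms(2) by (simp add: lin_subspace_def)
  with valued_order_disjoint[OF assms(1) this] show ?thesis by (simp del: uminus_apply)
qed

text \<open>Since \<open>\<phi> (x - z)\<close> is the truth value of \<open>x > z\<close>, this is
  negative transitivity of the strict relation.\<close>

lemma valued_order_diff:
  assumes "valued_order S \<phi>" "lin_subspace S" "x \<in> S" "y \<in> S" "z \<in> S"
  shows "\<phi> (x - z) \<le> \<phi> (x - y) \<curlyvee> \<phi> (y - z)"
  using valued_order_add[OF assms(1) lin_subspace_diff[OF assms(2-4)] lin_subspace_diff[OF assms(2,4,5)]]
  by simp

lemma valued_order_scale_eq:
  assumes "valued_order S \<phi>" "x \<in> S" "y \<in> S" "0 < c" "0 < d" "c *\<^sub>V x = d *\<^sub>V y"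
  shows "\<phi> x = \<phi> y"
  using assms by (metis valued_order_scale)

text \<open>
  A new vector \<open>t\<close> is described by the truth values \<open>u x\<close> of \<open>x < t\<close> and \<open>v x\<close> of \<open>x > t\<close>.
\<close>

definition cut :: "(('i \<Rightarrow> 'k :: {division_ring, linordered_ring}) \<Rightarrow>
    'l :: {distrib_lattice, bounded_lattice_bot}) \<Rightarrow> 'j set \<Rightarrow> ('j \<Rightarrow> 'i \<Rightarrow> 'k) \<Rightarrow>
    ('j \<Rightarrow> 'l \<times> 'l) \<Rightarrow> bool"
  where "cut \<phi> A e w \<longleftrightarrow> (\<forall>i\<in>A. fst (w i) \<curlywedge> snd (w i) = bot) \<and> (\<forall>i\<in>A. \<forall>j\<in>A.
    fst (w i) \<le> fst (w j) \<curlyvee> \<phi> (e j - e i) \<and> snd (w i) \<le> snd (w j) \<curlyvee> \<phi> (e i - e j) \<and>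
    \<phi> (e i - e j) \<le> fst (w j) \<curlyvee> snd (w i))"

text \<open>Meeting the witnesses of complete normality with \<open>a\<close> and \<open>b\<close>
  makes them disjoint shrinkings of these two elements. What either element loses in the process is
  covered by the other one.\<close>

lemma completely_normal_disjoint:
  fixes a b :: "'l :: {distrib_lattice, bounded_lattice_bot}"
  assumes "completely_normal TYPE('l)"
  shows "\<exists>x y. x \<le> a \<and> y \<le> b \<and> x \<curlywedge> y = bot \<and> a \<le> x \<curlyvee> b \<and> b \<le> a \<curlyvee> y"
proof -
  obtain x y where xy: "a \<curlyvee> b = a \<curlyvee> y" "a \<curlyvee> b = x \<curlyvee> b" "x \<curlywedge> y = bot"
    using assms unfolding completely_normal_def by metis
  have "(x \<curlywedge> a) \<curlywedge> (y \<curlywedge> b) \<le> x \<curlywedge> y" by (intro inf_mono inf_le1)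
  then have "(x \<curlywedge> a) \<curlywedge> (y \<curlywedge> b) = bot" using xy(3) by (simp add: bot_unique)
  moreover have "a \<le> x \<curlywedge> a \<curlyvee> b" using xy(2) by (metis sup_inf_distrib2 le_inf_iff sup_ge1)
  moreover have "b \<le> a \<curlyvee> y \<curlywedge> b" using xy(1) by (metis sup_inf_distrib1 le_inf_iff sup_ge2)
  ultimately show ?thesis by (meson inf_le2)
qed

text \<open>
  The largest admissible values at the new point are finite meets; complete normality makes them
  disjoint, and what gets lost is recovered from the disjointness of the other values.
\<close>

lemma cut_extend:
  fixes \<phi> :: "('i \<Rightarrow> 'k :: {division_ring, linordered_ring}) \<Rightarrow>
    'l :: {distrib_lattice, bounded_lattice_bot}"
  assumes cn: "completely_normal TYPE('l)"
    and \<phi>: "valued_order S \<phi>" and S: "lin_subspace S"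
    and A: "finite A" "A \<noteq> {}" "k \<notin> A" and e: "\<And>i. e i \<in> S"
    and w: "cut \<phi> A e w"
  shows "\<exists>r. cut \<phi> (insert k A) e (w(k := r))"
proof -
  define z where "z = e k"
  let ?u = "\<lambda>i. fst (w i)" and ?v = "\<lambda>i. snd (w i)"
  have z: "z \<in> S" using e by (simp add: z_def)
  have disj: "?u i \<curlywedge> ?v i = bot" if "i \<in> A" for i
    using w that by (simp add: cut_def)
  have uu: "?u i \<le> ?u j \<curlyvee> \<phi> (e j - e i)" and vv: "?v i \<le> ?v j \<curlyvee> \<phi> (e i - e j)"
    and uv: "\<phi> (e i - e j) \<le> ?u j \<curlyvee> ?v i" if "i \<in> A" "j \<in> A" for i j
    using w that by (simp_all add: cut_def)
  have tri: "\<phi> (x - y) \<le> \<phi> (x - z') \<curlyvee> \<phi> (z' - y)" if "x \<in> S" "y \<in> S" "z' \<in> S" for x y z'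
    using valued_order_diff[OF \<phi> S] that by blast
  have opp: "\<phi> (x - y) \<curlywedge> \<phi> (y - x) = bot" if "x \<in> S" "y \<in> S" for x y
    using valued_order_disjoint[OF \<phi> lin_subspace_diff[OF S that]] by simp
  obtain U where U: "\<And>i. i \<in> A \<Longrightarrow> U \<le> ?u i \<curlyvee> \<phi> (e i - z)"
    "\<And>s b. (\<And>i. i \<in> A \<Longrightarrow> s \<le> (?u i \<curlyvee> \<phi> (e i - z)) \<curlyvee> b) \<Longrightarrow> s \<le> U \<curlyvee> b"
    using finite_meet_exists[OF A(1,2), of "\<lambda>i. ?u i \<curlyvee> \<phi> (e i - z)"] by blast
  obtain V where V: "\<And>i. i \<in> A \<Longrightarrow> V \<le> ?v i \<curlyvee> \<phi> (z - e i)"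
    "\<And>s b. (\<And>i. i \<in> A \<Longrightarrow> s \<le> (?v i \<curlyvee> \<phi> (z - e i)) \<curlyvee> b) \<Longrightarrow> s \<le> V \<curlyvee> b"
    using finite_meet_exists[OF A(1,2), of "\<lambda>i. ?v i \<curlyvee> \<phi> (z - e i)"] by blast
  \<comment> \<open>The four facts \<open>U1\<close>, \<open>U2\<close>, \<open>V1\<close>,
    \<open>V2\<close> are the lower bounds demanded of the new values. Each bound lies below every
    term of the meet, by transitivity and the conditions at the old indices, hence below the meet up
    to its side term.\<close>
  have U1: "?u i \<le> U \<curlyvee> \<phi> (z - e i)" if "i \<in> A" for i
  proof (rule U(2))
    fix j assume j: "j \<in> A"
    have "?u i \<le> ?u j \<curlyvee> \<phi> (e j - e i)" using uu that j .
    also have "\<dots> \<le> ?u j \<curlyvee> (\<phi> (e j - z) \<curlyvee> \<phi> (z - e i))"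
      by (intro sup_mono order_refl tri e z)
    finally show "?u i \<le> (?u j \<curlyvee> \<phi> (e j - z)) \<curlyvee> \<phi> (z - e i)" by (simp add: sup_assoc)
  qed
  have U2: "\<phi> (e i - z) \<le> U \<curlyvee> ?v i" if "i \<in> A" for i
  proof (rule U(2))
    fix j assume j: "j \<in> A"
    have "\<phi> (e i - z) \<le> \<phi> (e i - e j) \<curlyvee> \<phi> (e j - z)" by (intro tri e z)
    also have "\<dots> \<le> (?u j \<curlyvee> ?v i) \<curlyvee> \<phi> (e j - z)" using uv[OF that j] by (intro sup_mono order_refl)
    finally show "\<phi> (e i - z) \<le> (?u j \<curlyvee> \<phi> (e j - z)) \<curlyvee> ?v i" by (simp add: ac_simps)
  qed
  have V1: "?v i \<le> V \<curlyvee> \<phi> (e i - z)" if "i \<in> A" for i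
  proof (rule V(2))
    fix j assume j: "j \<in> A"
    have "?v i \<le> ?v j \<curlyvee> \<phi> (e i - e j)" using vv that j .
    also have "\<dots> \<le> ?v j \<curlyvee> (\<phi> (e i - z) \<curlyvee> \<phi> (z - e j))"
      by (intro sup_mono order_refl tri e z)
    finally show "?v i \<le> (?v j \<curlyvee> \<phi> (z - e j)) \<curlyvee> \<phi> (e i - z)" by (simp add: ac_simps)
  qed
  have V2: "\<phi> (z - e i) \<le> V \<curlyvee> ?u i" if "i \<in> A" for i
  proof (rule V(2))
    fix j assume j: "j \<in> A"
    have "\<phi> (z - e i) \<le> \<phi> (z - e j) \<curlyvee> \<phi> (e j - e i)" by (intro tri e z)
    also have "\<dots> \<le> \<phi> (z - e j) \<curlyvee> (?u i \<curlyvee> ?v j)" using uv[OF j that] by (intro sup_mono order_refl)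
    finally show "\<phi> (z - e i) \<le> (?v j \<curlyvee> \<phi> (z - e j)) \<curlyvee> ?u i" by (simp add: ac_simps)
  qed
  obtain u v where r: "u \<le> U" "v \<le> V" "u \<curlywedge> v = bot" "U \<le> u \<curlyvee> V" "V \<le> U \<curlyvee> v"
    using completely_normal_disjoint[OF cn] by blast
  \<comment> \<open>Here \<open>b\<close> is a maximal value, \<open>a\<close> its shrinking, and
    the loss is below \<open>b'\<close>, the opposite maximal value. As \<open>b'\<close> lies below
    an upper bound \<open>q\<close> that meets \<open>s\<close> only inside \<open>c\<close>, the
    loss does not affect the bound on \<open>s\<close>.\<close>
  have recover: "s \<le> a \<curlyvee> c" if "s \<le> b \<curlyvee> c" "b \<le> a \<curlyvee> b'" "b' \<le> q" "s \<curlywedge> q \<le> c"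
    for s a b b' c q :: 'l
  proof (rule distrib_lattice_cut)
    have "s \<le> (a \<curlyvee> b') \<curlyvee> c" using that(1,2) by (meson order_trans sup_mono order_refl)
    then show "s \<le> (a \<curlyvee> c) \<curlyvee> b'" by (simp add: ac_simps)
    have "s \<curlywedge> b' \<le> c" using that(3,4) by (meson order_trans inf_mono order_refl)
    then show "s \<curlywedge> b' \<le> a \<curlyvee> c" by (rule le_supI2)
  qed
  have disjl: "s \<curlywedge> (p \<curlyvee> c) \<le> c" if "s \<curlywedge> p = bot" for s p c :: 'l
    using that by (simp add: inf_sup_distrib1)
  have disjr: "s \<curlywedge> (c \<curlyvee> p) \<le> c" if "s \<curlywedge> p = bot" for s p c :: 'l
    using that by (simp add: inf_sup_distrib1)
  have V': "V \<le> v \<curlyvee> U" using r(5) by (simp add: ac_simps)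
  have n1: "?u i \<le> u \<curlyvee> \<phi> (z - e i)" if "i \<in> A" for i
    using recover[OF U1[OF that] r(4) V(1)[OF that] disjl] disj[OF that] by blast
  have n2: "\<phi> (e i - z) \<le> u \<curlyvee> ?v i" if "i \<in> A" for i
    using recover[OF U2[OF that] r(4) V(1)[OF that] disjr] opp[OF e z] by blast
  have n3: "?v i \<le> v \<curlyvee> \<phi> (e i - z)" if "i \<in> A" for i
    using recover[OF V1[OF that] V' U(1)[OF that] disjl] disj[OF that] by (simp add: ac_simps)
  have n4: "\<phi> (z - e i) \<le> v \<curlyvee> ?u i" if "i \<in> A" for i
    using recover[OF V2[OF that] V' U(1)[OF that] disjr] opp[OF z e] by blast
  have n5: "u \<le> ?u i \<curlyvee> \<phi> (e i - z)" "v \<le> ?v i \<curlyvee> \<phi> (z - e i)" if "i \<in> A" for i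
    using r(1,2) U(1)[OF that] V(1)[OF that] by (blast intro: order_trans)+
  have "cut \<phi> (insert k A) e (w(k := (u, v)))"
    using A(3) valued_order_zero[OF \<phi> S] r(3) disj uu vv uv n1 n2 n3 n4 n5
    unfolding cut_def by (auto simp: z_def[symmetric] ac_simps simp del: minus_apply split: if_splits)
  then show ?thesis by blast
qed

section \<open>Adjoining vectors\<close>

text \<open>Every condition on a cut involves at most two vectors, so it suffices to satisfy the
  conditions on each finite piece of an enumeration without ever revising an earlier value.\<close>

lemma cut_exists_countable:
  fixes \<phi> :: "('i \<Rightarrow> 'k :: {division_ring, linordered_ring}) \<Rightarrow>
    'l :: {distrib_lattice, bounded_lattice_bot}"
  assumes cn: "completely_normal TYPE('l)"
    and \<phi>: "valued_order S \<phi>" and S: "lin_subspace S" "countable S"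
  shows "\<exists>w. cut \<phi> S (\<lambda>x. x) w \<and> w 0 = (a, bot)"
proof -
  \<comment> \<open>Position 0 is reserved for the zero vector, whose value is prescribed. Vectors
    may recur at later positions; this is harmless because the cut is indexed by positions.\<close>
  define e where "e = (\<lambda>n. case n of 0 \<Rightarrow> 0 | Suc m \<Rightarrow> from_nat_into S m)"
  have "0 \<in> S" using S(1) by (simp add: lin_subspace_def)
  then have eS: "e n \<in> S" for n
    using from_nat_into[of S] by (auto simp: e_def split: nat.split)
  \<comment> \<open>The vacuous update \<open>g(n := g n)\<close> separates the value being chosen
    from the earlier ones, as the recursion principle requires.\<close>
  have "\<exists>g. \<forall>n. cut \<phi> {..n} e (g(n := g n)) \<and> (n = 0 \<longrightarrow> g n = (a, bot))"
  proof (rule dependent_wf_choice[OF wf_less_than])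
    fix f g :: "nat \<Rightarrow> 'l \<times> 'l" and n r
    assume "\<And>m. (m, n) \<in> less_than \<Longrightarrow> f m = g m"
    then have "\<And>m. m \<in> {..n} \<Longrightarrow> (f(n := r)) m = (g(n := r)) m" by auto
    then have "cut \<phi> {..n} e (f(n := r)) = cut \<phi> {..n} e (g(n := r))"
      unfolding cut_def by (intro arg_cong2[of _ _ _ _ "(\<and>)"] ball_cong refl) (simp_all only:)
    then show "(cut \<phi> {..n} e (f(n := r)) \<and> (n = 0 \<longrightarrow> r = (a, bot))) =
        (cut \<phi> {..n} e (g(n := r)) \<and> (n = 0 \<longrightarrow> r = (a, bot)))"
      by simp
  next
    fix n and f :: "nat \<Rightarrow> 'l \<times> 'l"
    assume prev: "\<And>m. (m, n) \<in> less_than \<Longrightarrow>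
      cut \<phi> {..m} e (f(m := f m)) \<and> (m = 0 \<longrightarrow> f m = (a, bot))"
    show "\<exists>r. cut \<phi> {..n} e (f(n := r)) \<and> (n = 0 \<longrightarrow> r = (a, bot))"
    proof (cases n)
      case 0
      have "cut \<phi> {..n} e (f(n := (a, bot)))"
        using valued_order_zero[OF \<phi> S(1)] by (simp add: cut_def 0)
      then show ?thesis by blast
    next
      case (Suc m)
      then have "cut \<phi> {..m} e f" using prev[of m] by simp
      then have "\<exists>r. cut \<phi> (insert n {..m}) e (f(n := r))"
        by (intro cut_extend[OF cn \<phi> S(1)] eS) (auto simp: Suc)
      then show ?thesis by (simp add: Suc atMost_Suc)
    qed
  qed
  then obtain g where g: "\<And>n. cut \<phi> {..n} e g" "g 0 = (a, bot)" by auto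
  define idx where "idx x = (if x = 0 then 0 else Suc (to_nat_on S x))" for x
  have e_idx: "e (idx x) = x" if "x \<in> S" for x
    using that S(2) by (simp add: e_def idx_def)
  have "cut \<phi> S (\<lambda>x. x) (g \<circ> idx)"
    unfolding cut_def
  proof (rule conjI; intro ballI)
    fix x assume "x \<in> S"
    show "fst ((g \<circ> idx) x) \<curlywedge> snd ((g \<circ> idx) x) = bot"
      using g(1)[of "idx x"] by (simp add: cut_def)
  next
    fix x y assume xy: "x \<in> S" "y \<in> S"
    have "idx x \<in> {..max (idx x) (idx y)}" "idx y \<in> {..max (idx x) (idx y)}" by auto
    then show "fst ((g \<circ> idx) x) \<le> fst ((g \<circ> idx) y) \<curlyvee> \<phi> (y - x) \<and>
        snd ((g \<circ> idx) x) \<le> snd ((g \<circ> idx) y) \<curlyvee> \<phi> (x - y) \<and>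
        \<phi> (x - y) \<le> fst ((g \<circ> idx) y) \<curlyvee> snd ((g \<circ> idx) x)"
      using g(1)[of "max (idx x) (idx y)"] e_idx[OF xy(1)] e_idx[OF xy(2)]
      unfolding cut_def comp_apply by metis
  qed
  moreover have "(g \<circ> idx) 0 = (a, bot)" using g(2) by (simp add: idx_def)
  ultimately show ?thesis by blast
qed

lemma scale_scale: "c *\<^sub>V d *\<^sub>V x = (c * d) *\<^sub>V x"
  for c d :: "'k :: semigroup_mult"
  by (simp add: fun_eq_iff mult.assoc)

text \<open>A vector with \<open>x l \<noteq> 0\<close> is \<open>x l\<close> times the difference
  between the new basis vector and a vector of \<open>S\<close>. Its sign is therefore dictated by
  the cut that the new vector makes in \<open>S\<close> and by the sign of \<open>x l\<close>. The
  value \<open>a\<close> is the one prescribed for the cut at 0.\<close>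

lemma valued_order_adjoin:
  fixes \<phi> :: "('i \<Rightarrow> 'k :: {division_ring, linordered_ring}) \<Rightarrow>
    'l :: {distrib_lattice, bounded_lattice_bot}"
  assumes cn: "completely_normal TYPE('l)"
    and \<phi>: "valued_order S \<phi>" and S: "lin_subspace S" "countable S"
    and l: "\<And>x. x \<in> S \<Longrightarrow> x l = 0"
  shows "\<exists>\<psi>. valued_order {x. x(l := 0) \<in> S} \<psi> \<and> (\<forall>x\<in>S. \<psi> x = \<phi> x) \<and> \<psi> (unit_vec l) = a"
proof -
  obtain w where w: "cut \<phi> S (\<lambda>x. x) w" "w 0 = (a, bot)"
    using cut_exists_countable[OF cn \<phi> S] by blast
  define u v where "u = fst \<circ> w" and "v = snd \<circ> w"
  have uv: "u x \<curlywedge> v x = bot" "v x \<curlywedge> u x = bot" if "x \<in> S" for x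
    using w(1) that by (auto simp: cut_def u_def v_def inf_commute)
  have u_le: "u x \<le> u y \<curlyvee> \<phi> (y - x)" and v_le: "v x \<le> v y \<curlyvee> \<phi> (x - y)"
    and \<phi>_le: "\<phi> (x - y) \<le> u y \<curlyvee> v x" if "x \<in> S" "y \<in> S" for x y
    using w(1) that by (auto simp: cut_def u_def v_def)
  have opp: "\<phi> (x - y) \<curlywedge> \<phi> (y - x) = bot" if "x \<in> S" "y \<in> S" for x y
    using valued_order_disjoint[OF \<phi> lin_subspace_diff[OF S(1) that]] by simp
  have dS: "x - y \<in> S" if "x \<in> S" "y \<in> S" for x y using lin_subspace_diff[OF S(1) that] .
  have sS: "c *\<^sub>V x \<in> S" if "x \<in> S" for c x using S(1) that by (simp add: lin_subspace_def)
  have aS: "x + y \<in> S" if "x \<in> S" "y \<in> S" for x y using S(1) that by (simp add: lin_subspace_def)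
  have \<phi>_eq: "\<phi> x = \<phi> y" if "x \<in> S" "y \<in> S" "0 < c" "0 < d" "c *\<^sub>V x = d *\<^sub>V y" for x y c d
    using valued_order_scale_eq[OF \<phi> that] .
  \<comment> \<open>Solves \<open>x = x l *\<^sub>V (unit_vec l - \<kappa> x)\<close> for
    \<open>\<kappa> x\<close>; scalars need not commute, so the inverse must stand on the
    left.\<close>
  define \<kappa> where "\<kappa> x = (- inverse (x l)) *\<^sub>V x(l := 0)" for x :: "'i \<Rightarrow> 'k"
  define \<psi> where "\<psi> x = (if x l = 0 then \<phi> x else if 0 < x l then u (\<kappa> x) else v (\<kappa> x))" for x
  let ?T = "{x. x(l := 0) \<in> S}"
  have \<kappa>S: "\<kappa> x \<in> S" if "x \<in> ?T" for x using that sS by (simp add: \<kappa>_def)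
  have S_if: "x \<in> S" if "x \<in> ?T" "x l = 0" for x
  proof -
    have "x(l := 0) = x" using that(2) by auto
    with that(1) show ?thesis by simp
  qed
  have \<kappa>: "x l * \<kappa> x i = (if i = l then 0 else - x i)" if "x l \<noteq> 0" for x i
    using that by (simp add: \<kappa>_def mult.assoc[symmetric])
  have \<kappa>_eqI: "\<kappa> x = y" if "x l \<noteq> 0" "y l = 0" "\<And>i. i \<noteq> l \<Longrightarrow> x l * y i = - x i" for x y
  proof
    fix i
    have "x l * \<kappa> x i = x l * y i" using \<kappa>[of x i] that by auto
    then show "\<kappa> x i = y i" using that(1) by simp
  qed
  have \<kappa>l: "\<kappa> x l = 0" for x by (simp add: \<kappa>_def)
  have \<kappa>_scale: "\<kappa> (c *\<^sub>V x) = \<kappa> x" if "c \<noteq> 0" "x l \<noteq> 0" for c x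
    by (rule \<kappa>_eqI) (use that \<kappa>[of x] in \<open>simp_all add: \<kappa>l mult.assoc\<close>)
  have \<kappa>_uminus: "\<kappa> (- x) = \<kappa> x" if "x l \<noteq> 0" for x
    by (rule \<kappa>_eqI) (use that \<kappa>[of x] in \<open>simp_all add: \<kappa>l\<close>)
  \<comment> \<open>The vector \<open>\<kappa> (x + y)\<close> is the average of
    \<open>\<kappa> x\<close> and \<open>\<kappa> y\<close> with weights \<open>x l\<close> and
    \<open>y l\<close>. Its differences from the two are therefore proportional to
    \<open>\<kappa> y - \<kappa> x\<close>, and only the signs of the factors matter to
    \<phi>.\<close>
  have \<kappa>_add: "(x l + y l) *\<^sub>V (\<kappa> (x + y) - \<kappa> x) = y l *\<^sub>V (\<kappa> y - \<kappa> x)"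
    if "x l \<noteq> 0" "y l \<noteq> 0" "x l + y l \<noteq> 0" for x y
  proof
    fix i
    have "(x l + y l) * \<kappa> (x + y) i = x l * \<kappa> x i + y l * \<kappa> y i"
      using \<kappa>[of "x + y" i] \<kappa>[of x i] \<kappa>[of y i] that by simp
    then show "((x l + y l) *\<^sub>V (\<kappa> (x + y) - \<kappa> x)) i = (y l *\<^sub>V (\<kappa> y - \<kappa> x)) i"
      by (simp add: algebra_simps)
  qed
  have \<kappa>_add': "(x l + y l) *\<^sub>V (\<kappa> (x + y) - \<kappa> y) = x l *\<^sub>V (\<kappa> x - \<kappa> y)"
    if "x l \<noteq> 0" "y l \<noteq> 0" "x l + y l \<noteq> 0" for x y
    using \<kappa>_add[of y x] that by (simp add: add.commute)
  have scale_minus: "(- c) *\<^sub>V (x - y) = c *\<^sub>V (y - x)" for c and x y :: "'i \<Rightarrow> 'k"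
    by (simp add: fun_eq_iff algebra_simps)
  have same_sign: "\<phi> (x - y) = \<phi> (z - z') \<and> \<phi> (y - x) = \<phi> (z' - z)"
    if "x \<in> S" "y \<in> S" "z \<in> S" "z' \<in> S" "c *\<^sub>V (x - y) = d *\<^sub>V (z - z')" "0 < c \<and> 0 < d \<or> c < 0 \<and> d < 0"
    for x y z z' c d
  proof -
    have "(- c) *\<^sub>V (x - y) = (- d) *\<^sub>V (z - z')" "c *\<^sub>V (y - x) = d *\<^sub>V (z' - z)"
      "(- c) *\<^sub>V (y - x) = (- d) *\<^sub>V (z' - z)"
      using that(5) by (simp_all add: fun_eq_iff algebra_simps)
    with that(5,6) show ?thesis
      using \<phi>_eq[OF dS[OF that(1,2)] dS[OF that(3,4)], of c d] \<phi>_eq[OF dS[OF that(2,1)] dS[OF that(4,3)], of c d]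
        \<phi>_eq[OF dS[OF that(1,2)] dS[OF that(3,4)], of "- c" "- d"]
        \<phi>_eq[OF dS[OF that(2,1)] dS[OF that(4,3)], of "- c" "- d"]
      unfolding neg_0_less_iff_less by blast
  qed
  have opposite_sign: "\<phi> (x - y) = \<phi> (z' - z) \<and> \<phi> (y - x) = \<phi> (z - z')"
    if "x \<in> S" "y \<in> S" "z \<in> S" "z' \<in> S" "c *\<^sub>V (x - y) = d *\<^sub>V (z - z')" "0 < c \<and> d < 0 \<or> c < 0 \<and> 0 < d"
    for x y z z' c d
    using same_sign[of x y z' z c "- d"] that by (simp add: scale_minus)
  have absorb: "p \<le> q \<curlyvee> q'" if "p \<le> q \<curlyvee> c" "c \<le> q \<curlyvee> q'" for p q q' c :: 'l
    by (rule order_trans[OF that(1)]) (use that(2) in simp)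
  have absorb': "p \<le> q' \<curlyvee> q" if "p \<le> q \<curlyvee> c" "c \<le> q' \<curlyvee> q" for p q q' c :: 'l
    by (rule order_trans[OF that(1)]) (use that(2) in simp)
  \<comment> \<open>Needed when both weights have the same sign. Then
    \<open>\<kappa> (x + y)\<close> lies between \<open>\<kappa> x\<close> and
    \<open>\<kappa> y\<close>, and the error terms \<open>c\<close> and \<open>c'\<close> are values
    of \<phi> at opposite vectors, hence disjoint.\<close>
  have between: "a \<le> b \<curlyvee> b'" if "a \<le> b \<curlyvee> c" "a \<le> b' \<curlyvee> c'" "c \<curlywedge> c' = bot" for a b b' c c' :: 'l
  proof -
    have "a \<le> ((b \<curlyvee> b') \<curlyvee> c) \<curlywedge> ((b \<curlyvee> b') \<curlyvee> c')"
      by (intro le_infI order_trans[OF that(1)] order_trans[OF that(2)] sup_mono sup_ge1 sup_ge2 order_refl)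
    then show ?thesis using that(3) by (simp add: sup_inf_distrib1[symmetric])
  qed
  have addT: "x + y \<in> ?T" if "x \<in> ?T" "y \<in> ?T" for x y
  proof -
    have "(x + y)(l := 0) = x(l := 0) + y(l := 0)" by (simp add: fun_eq_iff)
    with that aS show ?thesis by (simp only: mem_Collect_eq)
  qed
  \<comment> \<open>The assumption \<open>c\<close> keeps six of the nine sign patterns of
    \<open>x l\<close> and \<open>y l\<close>; exchanging \<open>x\<close> and \<open>y\<close>
    yields the other three.\<close>
  have add: "\<psi> (x + y) \<le> \<psi> x \<curlyvee> \<psi> y" if x: "x \<in> ?T" and y: "y \<in> ?T"
    and c: "x l = 0 \<or> (y l \<noteq> 0 \<and> (x l > 0 \<or> y l < 0))" for x y
  proof -
    note kx = \<kappa>S[OF x] and ky = \<kappa>S[OF y] and kxy = \<kappa>S[OF addT[OF x y]]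
    consider "x l = 0" "y l = 0" | "x l = 0" "y l > 0" | "x l = 0" "y l < 0"
      | "x l > 0" "y l > 0" | "x l < 0" "y l < 0" | "x l > 0" "y l < 0"
      using c by fastforce
    then show ?thesis
    proof cases
      case 1
      then show ?thesis using valued_order_add[OF \<phi> S_if[OF x] S_if[OF y]] by (auto simp: \<psi>_def)
    next
      case 2
      have "\<kappa> (x + y) = \<kappa> y - inverse (y l) *\<^sub>V x"
        by (rule \<kappa>_eqI) (use 2 \<kappa>[of y] in \<open>simp_all add: \<kappa>l right_diff_distrib mult.assoc[symmetric]\<close>)
      then have "\<kappa> y - \<kappa> (x + y) = inverse (y l) *\<^sub>V x" by simp
      then have "\<phi> (\<kappa> y - \<kappa> (x + y)) = \<phi> x"
        using valued_order_scale[OF \<phi> S_if[OF x 2(1)]] ordered_division_ring_inverse_pos[OF 2(2)] by simp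
      with u_le[OF kxy ky] 2 show ?thesis by (auto simp: \<psi>_def sup_commute)
    next
      case 3
      have "\<kappa> (x + y) = \<kappa> y - inverse (y l) *\<^sub>V x"
        by (rule \<kappa>_eqI) (use 3 \<kappa>[of y] in \<open>simp_all add: \<kappa>l right_diff_distrib mult.assoc[symmetric]\<close>)
      then have "\<kappa> (x + y) - \<kappa> y = inverse (- y l) *\<^sub>V x" using 3 by (simp add: fun_eq_iff)
      then have "\<phi> (\<kappa> (x + y) - \<kappa> y) = \<phi> x"
        using valued_order_scale[OF \<phi> S_if[OF x 3(1)]] ordered_division_ring_inverse_pos[of "- y l"] 3(2)
        by (simp del: inverse_minus_eq)
      with v_le[OF kxy ky] 3 show ?thesis by (auto simp: \<psi>_def sup_commute)
    next
      case 4
      then have "x l + y l > 0" by (simp add: add_pos_pos)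
      with 4 have r: "\<phi> (\<kappa> x - \<kappa> (x + y)) = \<phi> (\<kappa> x - \<kappa> y)" "\<phi> (\<kappa> y - \<kappa> (x + y)) = \<phi> (\<kappa> y - \<kappa> x)"
        using same_sign[OF kxy kx ky kx \<kappa>_add[of x y]] same_sign[OF kxy ky kx ky \<kappa>_add'[of x y]] by auto
      have "u (\<kappa> (x + y)) \<le> u (\<kappa> x) \<curlyvee> u (\<kappa> y)"
        using between[OF _ _ opp[OF kx ky]] u_le[OF kxy kx] u_le[OF kxy ky] unfolding r by blast
      then show ?thesis using 4 \<open>x l + y l > 0\<close> by (auto simp: \<psi>_def)
    next
      case 5
      then have "x l + y l < 0" by (simp add: add_neg_neg)
      with 5 have r: "\<phi> (\<kappa> (x + y) - \<kappa> x) = \<phi> (\<kappa> y - \<kappa> x)" "\<phi> (\<kappa> (x + y) - \<kappa> y) = \<phi> (\<kappa> x - \<kappa> y)"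
        using same_sign[OF kxy kx ky kx \<kappa>_add[of x y]] same_sign[OF kxy ky kx ky \<kappa>_add'[of x y]] by auto
      have "v (\<kappa> (x + y)) \<le> v (\<kappa> x) \<curlyvee> v (\<kappa> y)"
        using between[OF _ _ opp[OF ky kx]] v_le[OF kxy kx] v_le[OF kxy ky] unfolding r by blast
      then show ?thesis using 5 \<open>x l + y l < 0\<close> by (auto simp: \<psi>_def)
    next
      case 6
      \<comment> \<open>With weights of opposite sign and nonzero sum,
        \<open>\<kappa> (x + y)\<close> lies outside the segment, beyond the end of larger absolute
        weight. All three cases reduce to the last condition on a cut: if
        \<open>\<kappa> y > \<kappa> x\<close>, then the new vector is above
        \<open>\<kappa> x\<close> or below \<open>\<kappa> y\<close>.\<close>
      have "\<psi> (x + y) \<le> u (\<kappa> x) \<curlyvee> v (\<kappa> y)"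
      proof (cases "x l + y l" "0 :: 'k" rule: linorder_cases)
        case less
        with 6 have r: "\<phi> (\<kappa> (x + y) - \<kappa> y) = \<phi> (\<kappa> y - \<kappa> x)"
          using opposite_sign[OF kxy ky kx ky \<kappa>_add'[of x y]] by simp
        have "v (\<kappa> (x + y)) \<le> u (\<kappa> x) \<curlyvee> v (\<kappa> y)"
          by (rule absorb'[OF v_le[OF kxy ky, unfolded r] \<phi>_le[OF ky kx]])
        then show ?thesis using less by (auto simp: \<psi>_def)
      next
        case equal
        have "x + y = x l *\<^sub>V (\<kappa> y - \<kappa> x)"
        proof
          fix i
          have "y l = - x l" "x l \<noteq> 0" using equal 6 by (auto simp: eq_neg_iff_add_eq_0 add.commute)
          then show "(x + y) i = (x l *\<^sub>V (\<kappa> y - \<kappa> x)) i"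
            using \<kappa>[of x i] \<kappa>[of y i] 6 by (cases "i = l") (auto simp: right_diff_distrib \<kappa>l)
        qed
        then have "\<phi> (x + y) = \<phi> (\<kappa> y - \<kappa> x)"
          using valued_order_scale[OF \<phi> dS[OF ky kx]] 6 by simp
        with \<phi>_le[OF ky kx] show ?thesis using equal by (auto simp: \<psi>_def)
      next
        case greater
        with 6 have r: "\<phi> (\<kappa> x - \<kappa> (x + y)) = \<phi> (\<kappa> y - \<kappa> x)"
          using opposite_sign[OF kxy kx ky kx \<kappa>_add[of x y]] by simp
        have "u (\<kappa> (x + y)) \<le> u (\<kappa> x) \<curlyvee> v (\<kappa> y)"
          by (rule absorb[OF u_le[OF kxy kx, unfolded r] \<phi>_le[OF ky kx]])
        then show ?thesis using greater by (auto simp: \<psi>_def)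
      qed
      then show ?thesis using 6 by (auto simp: \<psi>_def)
    qed
  qed
  have "valued_order ?T \<psi>"
    unfolding valued_order_def
  proof (intro conjI ballI allI impI)
    fix x c assume x: "x \<in> ?T" and c: "0 < (c :: 'k)"
    show "\<psi> (c *\<^sub>V x) = \<psi> x"
    proof (cases "x l = 0")
      case True
      then show ?thesis using valued_order_scale[OF \<phi> S_if[OF x True] c] by (auto simp: \<psi>_def)
    next
      case False
      moreover have "0 < c * x l \<longleftrightarrow> 0 < x l"
        using ordered_division_ring_mult_pos[OF c, of "x l"] ordered_division_ring_mult_pos[OF c, of "- x l"]
          False by (cases "0 < x l") (force simp: not_less less_le)+
      ultimately show ?thesis using \<kappa>_scale[of c x] c by (auto simp: \<psi>_def)
    qed
  next
    fix x assume x: "x \<in> ?T"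
    show "\<psi> x \<curlywedge> \<psi> (- x) = bot"
    proof (cases "x l = 0")
      case True
      then show ?thesis using valued_order_disjoint[OF \<phi> S_if[OF x True]] by (auto simp: \<psi>_def)
    next
      case False
      then show ?thesis using uv[OF \<kappa>S[OF x]] \<kappa>_uminus[of x] by (auto simp: \<psi>_def)
    qed
  next
    fix x y assume xy: "x \<in> ?T" "y \<in> ?T"
    have "x l = 0 \<or> (y l \<noteq> 0 \<and> (x l > 0 \<or> y l < 0)) \<or> y l = 0 \<or> (x l \<noteq> 0 \<and> (y l > 0 \<or> x l < 0))"
      by fastforce
    then show "\<psi> (x + y) \<le> \<psi> x \<curlyvee> \<psi> y"
      using add[OF xy] add[OF xy(2,1)] by (auto simp: sup_commute add.commute)
  qed
  moreover have "\<psi> x = \<phi> x" if "x \<in> S" for x using l[OF that] by (auto simp: \<psi>_def)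
  moreover have "\<psi> (unit_vec l) = a"
  proof -
    have "\<kappa> (unit_vec l) = 0" by (rule \<kappa>_eqI) (simp_all add: unit_vec_def)
    then show ?thesis
      using w(2) ordered_division_ring_zero_less_one[where 'k = 'k]
      by (simp add: \<psi>_def u_def unit_vec_def)
  qed
  ultimately show ?thesis by blast
qed

section \<open>Finitely supported vectors and the transfinite recursion\<close>

definition finsupp :: "'i set \<Rightarrow> ('i \<Rightarrow> 'k :: zero) set"
  where "finsupp I = {x. finite {i. x i \<noteq> 0} \<and> {i. x i \<noteq> 0} \<subseteq> I}"

lemma lin_subspace_finsupp: "lin_subspace (finsupp I :: ('i \<Rightarrow> 'k :: ring) set)"
  unfolding lin_subspace_def
proof (intro conjI ballI allI)
  show "0 \<in> (finsupp I :: ('i \<Rightarrow> 'k) set)" by (simp add: finsupp_def)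
next
  fix x y :: "'i \<Rightarrow> 'k" assume "x \<in> finsupp I" "y \<in> finsupp I"
  moreover have "{i. (x + y) i \<noteq> 0} \<subseteq> {i. x i \<noteq> 0} \<union> {i. y i \<noteq> 0}" by auto
  ultimately show "x + y \<in> finsupp I" unfolding finsupp_def by (auto intro: finite_subset)
next
  fix x :: "'i \<Rightarrow> 'k" and c assume "x \<in> finsupp I"
  moreover have "{i. (c *\<^sub>V x) i \<noteq> 0} \<subseteq> {i. x i \<noteq> 0}" by auto
  ultimately show "c *\<^sub>V x \<in> finsupp I" unfolding finsupp_def by (auto intro: finite_subset)
qed

lemma countable_finsupp:
  assumes "countable I" "countable (UNIV :: 'k :: zero set)"
  shows "countable (finsupp I :: ('i \<Rightarrow> 'k) set)"
proof -
  define dec where "dec ps = (\<lambda>i. case map_of ps i of None \<Rightarrow> 0 | Some c \<Rightarrow> c)" for ps :: "('i \<times> 'k) list"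
  have "x \<in> dec ` lists (I \<times> UNIV)" if "x \<in> finsupp I" for x :: "'i \<Rightarrow> 'k"
  proof -
    from that obtain ks where ks: "set ks = {i. x i \<noteq> 0}" "set ks \<subseteq> I"
      unfolding finsupp_def using finite_list[of "{i. x i \<noteq> 0}"] by auto
    have "dec (map (\<lambda>i. (i, x i)) ks) = x"
    proof
      fix i
      show "dec (map (\<lambda>i. (i, x i)) ks) i = x i"
        unfolding dec_def map_of_map_restrict restrict_map_def ks(1) by simp
    qed
    moreover have "map (\<lambda>i. (i, x i)) ks \<in> lists (I \<times> UNIV)" using ks(2) by auto
    ultimately show ?thesis by (rule image_eqI[OF sym])
  qed
  then have "(finsupp I :: ('i \<Rightarrow> 'k) set) \<subseteq> dec ` lists (I \<times> UNIV)" by blast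
  moreover have "countable (dec ` lists (I \<times> UNIV))" using assms by simp
  ultimately show ?thesis by (rule countable_subset)
qed

lemma finite_subset_under:
  assumes r: "Well_order r" "Field r = UNIV" and "finite A" "A \<subseteq> I" "I \<noteq> {}"
  shows "\<exists>m\<in>I. A \<subseteq> under r m"
  using assms(3-)
proof (induction A rule: finite_induct)
  case (insert a A)
  then obtain m where m: "m \<in> I" "A \<subseteq> under r m" by auto
  have "refl r" "trans r" "total r"
    using r by (auto simp: order_on_defs)
  then have "(a, m) \<in> r \<or> (m, a) \<in> r" by (metis UNIV_I reflD total_on_def)
  then show ?case
  proof
    assume "(a, m) \<in> r"
    with m show ?thesis by (auto simp: under_def)
  next
    assume "(m, a) \<in> r"
    with m \<open>refl r\<close> \<open>trans r\<close> have "insert a A \<subseteq> under r a"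
      by (auto simp: under_def dest: reflD transD)
    then show ?thesis using insert.prems by blast
  qed
qed auto

text \<open>A finite subset of \<open>I\<close> lies below a single index of \<open>I\<close>, and
  each law of an ordering involves at most two vectors, so it can be checked at one stage. The lemma
  serves every stage of the recursion, including the first with \<open>I\<close> empty, and the
  final union.\<close>

lemma valued_order_glue:
  fixes f :: "'i \<Rightarrow> ('i \<Rightarrow> 'k :: {division_ring, linordered_ring}) \<Rightarrow>
    'l :: {distrib_lattice, bounded_lattice_bot}"
  assumes r: "Well_order r" "Field r = UNIV"
    and f: "\<And>m. m \<in> I \<Longrightarrow> valued_order (finsupp (under r m)) (f m)"
    and coh: "\<And>m n x. \<lbrakk>n \<in> I; m \<in> underS r n; x \<in> finsupp (under r m)\<rbrakk> \<Longrightarrow> f n x = f m x"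
  shows "\<exists>\<phi>. valued_order (finsupp I) \<phi> \<and> (\<forall>m\<in>I. \<forall>x\<in>finsupp (under r m). \<phi> x = f m x)"
proof (cases "I = {}")
  case True
  have "valued_order (finsupp I) (\<lambda>_ :: 'i \<Rightarrow> 'k. bot :: 'l)" by (simp add: valued_order_def)
  then show ?thesis using True by blast
next
  case False
  have tot: "m = n \<or> m \<in> underS r n \<or> n \<in> underS r m" for m n
    using r by (auto simp: order_on_defs total_on_def underS_def)
  have eq: "f m x = f n x"
    if "m \<in> I" "n \<in> I" "x \<in> finsupp (under r m)" "x \<in> finsupp (under r n)" for m n x
    using tot[of m n] coh that by metis
  define \<phi> where "\<phi> x = f (SOME m. m \<in> I \<and> x \<in> finsupp (under r m)) x" for x
  have \<phi>: "\<phi> x = f m x" if "m \<in> I" "x \<in> finsupp (under r m)" for m x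
  proof -
    have "(SOME m. m \<in> I \<and> x \<in> finsupp (under r m)) \<in> I \<and>
        x \<in> finsupp (under r (SOME m. m \<in> I \<and> x \<in> finsupp (under r m)))"
      by (rule someI[of "\<lambda>m. m \<in> I \<and> x \<in> finsupp (under r m)"]) (use that in blast)
    then show ?thesis unfolding \<phi>_def using eq that by blast
  qed
  have ex: "\<exists>m\<in>I. x \<in> finsupp (under r m) \<and> y \<in> finsupp (under r m)"
    if "x \<in> finsupp I" "y \<in> finsupp I" for x y :: "'i \<Rightarrow> 'k"
    using finite_subset_under[OF r, of "{i. x i \<noteq> 0} \<union> {i. y i \<noteq> 0}" I] that False
    by (auto simp: finsupp_def)
  note sub = lin_subspace_finsupp[of "under r _", where 'k = 'k]
  have "valued_order (finsupp I) \<phi>"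
    unfolding valued_order_def
  proof (intro conjI ballI allI impI)
    fix x :: "'i \<Rightarrow> 'k" and c :: 'k assume "x \<in> finsupp I" "0 < c"
    with ex obtain m where m: "m \<in> I" "x \<in> finsupp (under r m)" by blast
    moreover from m have "c *\<^sub>V x \<in> finsupp (under r m)" using sub unfolding lin_subspace_def by blast
    ultimately show "\<phi> (c *\<^sub>V x) = \<phi> x" using valued_order_scale[OF f] \<phi> \<open>0 < c\<close> by simp
  next
    fix x :: "'i \<Rightarrow> 'k" assume "x \<in> finsupp I"
    with ex obtain m where m: "m \<in> I" "x \<in> finsupp (under r m)" by blast
    moreover from m have "- x \<in> finsupp (under r m)" by (intro lin_subspace_uminus sub)
    ultimately show "\<phi> x \<curlywedge> \<phi> (- x) = bot" using valued_order_disjoint[OF f] \<phi> by simp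
  next
    fix x y :: "'i \<Rightarrow> 'k" assume "x \<in> finsupp I" "y \<in> finsupp I"
    with ex obtain m where m: "m \<in> I" "x \<in> finsupp (under r m)" "y \<in> finsupp (under r m)" by blast
    moreover from m have "x + y \<in> finsupp (under r m)" using sub unfolding lin_subspace_def by blast
    ultimately show "\<phi> (x + y) \<le> \<phi> x \<curlyvee> \<phi> y" using valued_order_add[OF f] \<phi> by simp
  qed
  with \<phi> show ?thesis by blast
qed

lemma valued_order_exists:
  assumes k: "countable (UNIV :: 'k :: {division_ring, linordered_ring} set)"
    and cn: "completely_normal TYPE('l :: {distrib_lattice, bounded_lattice_bot})"
    and card: "|UNIV :: 'l set| \<le>o cardSuc natLeq"
  shows "\<exists>\<phi> :: ('l \<Rightarrow> 'k) \<Rightarrow> 'l. valued_order (finsupp UNIV) \<phi> \<and> (\<forall>l. \<phi> (unit_vec l) = l)"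
proof -
  \<comment> \<open>As a cardinal, \<open>r\<close> has proper initial segments of smaller
    cardinality than \<open>L\<close>, which makes them countable.\<close>
  define r where "r = |UNIV :: 'l set|"
  have r: "Well_order r" "Field r = UNIV"
    using card_of_well_order_on[of "UNIV :: 'l set"] by (simp_all add: r_def Field_card_of)
  have countable: "countable (underS r l)" for l
  proof -
    have "|underS r l| <o r"
      unfolding r_def by (rule card_of_underS[OF card_of_Card_order]) (simp add: Field_card_of)
    also have "r \<le>o cardSuc natLeq" using card by (simp add: r_def)
    finally show ?thesis
      using cardSuc_ordLeq_ordLess[OF natLeq_Card_order card_of_Card_order] countable_card_le_natLeq by blast
  qed
  have under: "under r l = insert l (underS r l)" for l
    using r by (auto simp: under_def underS_def order_on_defs dest: reflD)
  \<comment> \<open>Agreement with all earlier stages belongs to the invariant, since later stages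
    can glue the orderings only if they are coherent.\<close>
  define Q where "Q f l \<psi> \<longleftrightarrow> valued_order (finsupp (under r l)) \<psi> \<and> \<psi> (unit_vec l) = l \<and>
      (\<forall>m\<in>underS r l. \<forall>x\<in>finsupp (under r m). \<psi> x = f m x)"
    for f and l :: 'l and \<psi> :: "('l \<Rightarrow> 'k) \<Rightarrow> 'l"
  have "wf (r - Id)" using r(1) by (simp add: well_order_on_def)
  then have "\<exists>f. \<forall>l. Q f l (f l)"
  proof (rule dependent_wf_choice)
    fix f g :: "'l \<Rightarrow> ('l \<Rightarrow> 'k) \<Rightarrow> 'l" and l \<psi>
    assume "\<And>m. (m, l) \<in> r - Id \<Longrightarrow> f m = g m"
    then have "f m = g m" if "m \<in> underS r l" for m using that by (simp add: underS_def)
    then show "Q f l \<psi> = Q g l \<psi>" by (simp add: Q_def)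
  next
    fix l and f :: "'l \<Rightarrow> ('l \<Rightarrow> 'k) \<Rightarrow> 'l"
    assume "\<And>m. (m, l) \<in> r - Id \<Longrightarrow> Q f m (f m)"
    then have prev: "Q f m (f m)" if "m \<in> underS r l" for m using that by (simp add: underS_def)
    have "\<exists>\<phi>. valued_order (finsupp (underS r l)) \<phi> \<and>
        (\<forall>m\<in>underS r l. \<forall>x\<in>finsupp (under r m). \<phi> x = f m x)"
    proof (rule valued_order_glue[OF r])
      show "valued_order (finsupp (under r m)) (f m)" if "m \<in> underS r l" for m
        using prev[OF that] by (simp add: Q_def)
      show "f n x = f m x" if "n \<in> underS r l" "m \<in> underS r n" "x \<in> finsupp (under r m)" for m n x
        using prev[OF that(1)] that by (simp add: Q_def)
    qed
    then obtain \<phi> where \<phi>: "valued_order (finsupp (underS r l)) \<phi>"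
      "\<And>m x. \<lbrakk>m \<in> underS r l; x \<in> finsupp (under r m)\<rbrakk> \<Longrightarrow> \<phi> x = f m x" by blast
    have "x l = 0" if "x \<in> finsupp (underS r l)" for x :: "'l \<Rightarrow> 'k"
      using that by (auto simp: finsupp_def underS_def)
    then obtain \<psi> where \<psi>: "valued_order {x. x(l := 0) \<in> finsupp (underS r l)} \<psi>"
      "\<And>x. x \<in> finsupp (underS r l) \<Longrightarrow> \<psi> x = \<phi> x" "\<psi> (unit_vec l) = l"
      using valued_order_adjoin[OF cn \<phi>(1) lin_subspace_finsupp countable_finsupp[OF countable k]] by blast
    have "{x. x(l := 0) \<in> finsupp (underS r l)} = (finsupp (under r l) :: ('l \<Rightarrow> 'k) set)"
    proof -
      have "{i. (x(l := 0)) i \<noteq> 0} = {i. x i \<noteq> 0} - {l}" for x :: "'l \<Rightarrow> 'k" by auto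
      moreover have "A - {l} \<subseteq> underS r l \<longleftrightarrow> A \<subseteq> under r l" for A unfolding under by blast
      ultimately show ?thesis by (simp only: finsupp_def mem_Collect_eq finite_Diff2 finite.emptyI finite.insertI)
    qed
    moreover have "finsupp (under r m) \<subseteq> (finsupp (underS r l) :: ('l \<Rightarrow> 'k) set)" if "m \<in> underS r l" for m
    proof -
      have "under r m \<subseteq> underS r l"
        using that r(1) unfolding under_def underS_def order_on_defs by (auto dest: transD antisymD)
      then show ?thesis by (auto simp: finsupp_def)
    qed
    ultimately show "\<exists>\<psi>. Q f l \<psi>"
      using \<psi> \<phi>(2) by (intro exI[of _ \<psi>]) (auto simp: subset_iff Q_def)
  qed
  then obtain f where "\<And>l. Q f l (f l)" by blast
  then have f: "valued_order (finsupp (under r l)) (f l)" "f l (unit_vec l) = l"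
    "\<lbrakk>m \<in> underS r l; x \<in> finsupp (under r m)\<rbrakk> \<Longrightarrow> f l x = f m x" for l m x
    unfolding Q_def by blast+
  obtain \<phi> where "valued_order (finsupp UNIV) \<phi>" "\<And>m x. x \<in> finsupp (under r m) \<Longrightarrow> \<phi> x = f m x"
    using valued_order_glue[OF r f(1) f(3), where I = UNIV] by blast
  moreover have "unit_vec l \<in> (finsupp (under r l) :: ('l \<Rightarrow> 'k) set)" for l
    by (auto simp: finsupp_def under unit_vec_def)
  ultimately show ?thesis using f(2) by (metis (no_types))
qed

section \<open>The vector lattice of an ordering\<close>

lemma lattice_recordI:
  fixes L :: "('a, 'm) gorder_scheme"
  assumes eq: "eq L = (=)"
    and refl: "\<And>x. x \<in> carrier L \<Longrightarrow> le L x x"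
    and antisym: "\<And>x y. \<lbrakk>x \<in> carrier L; y \<in> carrier L; le L x y; le L y x\<rbrakk> \<Longrightarrow> x = y"
    and trans: "\<And>x y z. \<lbrakk>x \<in> carrier L; y \<in> carrier L; z \<in> carrier L; le L x y; le L y z\<rbrakk> \<Longrightarrow> le L x z"
    and sup: "\<And>x y. \<lbrakk>x \<in> carrier L; y \<in> carrier L\<rbrakk> \<Longrightarrow> \<exists>s\<in>carrier L. le L x s \<and> le L y s \<and>
      (\<forall>z\<in>carrier L. le L x z \<longrightarrow> le L y z \<longrightarrow> le L s z)"
    and inf: "\<And>x y. \<lbrakk>x \<in> carrier L; y \<in> carrier L\<rbrakk> \<Longrightarrow> \<exists>s\<in>carrier L. le L s x \<and> le L s y \<and>
      (\<forall>z\<in>carrier L. le L z x \<longrightarrow> le L z y \<longrightarrow> le L z s)"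
  shows "Lattice.lattice L"
proof
  show "\<exists>s. least L s (Upper L {x, y})" if "x \<in> carrier L" "y \<in> carrier L" for x y
    using sup[OF that] that by (auto simp: least_def Upper_def)
  show "\<exists>s. greatest L s (Lower L {x, y})" if "x \<in> carrier L" "y \<in> carrier L" for x y
    using inf[OF that] that by (auto simp: greatest_def Lower_def)
qed (use eq refl antisym in \<open>auto intro: trans\<close>)

lemma (in Lattice.lattice) join_eqI:
  assumes "x \<in> carrier L" "y \<in> carrier L" "s \<in> carrier L" "x \<sqsubseteq> s" "y \<sqsubseteq> s"
    and "\<And>z. \<lbrakk>z \<in> carrier L; x \<sqsubseteq> z; y \<sqsubseteq> z\<rbrakk> \<Longrightarrow> s \<sqsubseteq> z"
  shows "x \<squnion> y = s"
  using assms by (intro le_antisym join_le) (auto simp: join_left join_right)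

lemma (in Lattice.lattice) meet_eqI:
  assumes "x \<in> carrier L" "y \<in> carrier L" "s \<in> carrier L" "s \<sqsubseteq> x" "s \<sqsubseteq> y"
    and "\<And>z. \<lbrakk>z \<in> carrier L; z \<sqsubseteq> x; z \<sqsubseteq> y\<rbrakk> \<Longrightarrow> z \<sqsubseteq> s"
  shows "x \<sqinter> y = s"
  using assms by (intro le_antisym meet_le) (auto simp: meet_left meet_right)

text \<open>The injection \<open>J\<close> transports functions into the type that has to carry the
  vector lattice. The order \<open>r\<close> on the basis serves to break ties.\<close>

locale lattice_valued_order =
  fixes \<phi> :: "('i \<Rightarrow> 'k :: {division_ring, linordered_ring}) \<Rightarrow>
      'l :: {distrib_lattice, bounded_lattice_bot}"
    and r :: "'i rel" and J :: "('l set \<Rightarrow> 'i \<Rightarrow> 'k) \<Rightarrow> 'v"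
  assumes valued_order: "valued_order (finsupp UNIV) \<phi>"
    and linear_order: "linear_order r"
    and inj: "inj J"
begin

abbreviation "E \<equiv> finsupp UNIV :: ('i \<Rightarrow> 'k) set"

lemma E_closed: "0 \<in> E" "x \<in> E \<Longrightarrow> y \<in> E \<Longrightarrow> x + y \<in> E" "x \<in> E \<Longrightarrow> c *\<^sub>V x \<in> E"
    "x \<in> E \<Longrightarrow> - x \<in> E" "x \<in> E \<Longrightarrow> y \<in> E \<Longrightarrow> x - y \<in> E"
  using lin_subspace_finsupp[of "UNIV :: 'i set", where 'k = 'k]
    lin_subspace_uminus[OF lin_subspace_finsupp, of x UNIV]
    lin_subspace_diff[OF lin_subspace_finsupp, of x UNIV y]
  unfolding lin_subspace_def by blast+

section \<open>Total orders of the vector space, one at each set of lattice elements\<close>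

definition proper_prime :: "'l set \<Rightarrow> bool"
  where "proper_prime P \<longleftrightarrow> prime_filter P \<and> bot \<notin> P"

text \<open>Every subset \<open>P\<close> of \<open>L\<close> serves as a point. Where
  \<open>P\<close> is not a proper prime filter nothing is strictly positive in this sense, and the
  order at \<open>P\<close> is purely lexicographic.\<close>

definition pos0 :: "'l set \<Rightarrow> ('i \<Rightarrow> 'k) \<Rightarrow> bool"
  where "pos0 P x \<longleftrightarrow> proper_prime P \<and> \<phi> x \<in> P"

definition lex_pos :: "('i \<Rightarrow> 'k) \<Rightarrow> bool"
  where "lex_pos x \<longleftrightarrow> (\<exists>i. 0 < x i \<and> (\<forall>j. x j \<noteq> 0 \<longrightarrow> (j, i) \<in> r))"

text \<open>
  The total preordering at \<open>P\<close> need not be antisymmetric; refining it lexicographically avoids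
  quotient spaces.
\<close>

definition pos :: "'l set \<Rightarrow> ('i \<Rightarrow> 'k) \<Rightarrow> bool"
  where "pos P x \<longleftrightarrow> pos0 P x \<or> \<not> pos0 P (- x) \<and> lex_pos x"

text \<open>Primeness of \<open>P\<close> splits the join in the subadditivity of \<phi>.\<close>

lemma pos0_add: "\<lbrakk>pos0 P (x + y); x \<in> E; y \<in> E\<rbrakk> \<Longrightarrow> pos0 P x \<or> pos0 P y"
  using valued_order_add[OF valued_order, of x y] prime_filter_mono[of P "\<phi> (x + y)" "\<phi> x \<curlyvee> \<phi> y"]
  by (auto simp: pos0_def proper_prime_def prime_filter_def)

lemma pos0_asym: "\<lbrakk>pos0 P x; x \<in> E\<rbrakk> \<Longrightarrow> \<not> pos0 P (- x)"
  using valued_order_disjoint[OF valued_order, of x]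
  unfolding pos0_def proper_prime_def prime_filter_def by metis

lemma pos0_scale: "\<lbrakk>x \<in> E; 0 < c\<rbrakk> \<Longrightarrow> pos0 P (c *\<^sub>V x) \<longleftrightarrow> pos0 P x"
  using valued_order_scale[OF valued_order] by (simp add: pos0_def)

lemma pos0_zero: "\<not> pos0 P 0"
  using valued_order_zero[OF valued_order lin_subspace_finsupp] by (simp add: pos0_def proper_prime_def)

lemma lex_pos_add:
  assumes "lex_pos x" "lex_pos y"
  shows "lex_pos (x + y)"
proof -
  obtain i j where i: "0 < x i" "\<And>k. x k \<noteq> 0 \<Longrightarrow> (k, i) \<in> r"
    and j: "0 < y j" "\<And>k. y k \<noteq> 0 \<Longrightarrow> (k, j) \<in> r"
    using assms unfolding lex_pos_def by blast
  have r: "trans r" "antisym r" "total r" using linear_order by (simp_all add: order_on_defs)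
  have nz: "x k \<noteq> 0 \<or> y k \<noteq> 0" if "(x + y) k \<noteq> 0" for k using that by auto
  consider "i = j" | "(i, j) \<in> r" "i \<noteq> j" | "(j, i) \<in> r" "i \<noteq> j"
    using r(3) by (auto simp: total_on_def)
  then show ?thesis
  proof cases
    case 1
    then show ?thesis
      unfolding lex_pos_def using i j nz by (intro exI[of _ i]) (auto simp: add_pos_pos)
  next
    case 2
    then have "x j = 0" using i(2)[of j] r(2) by (auto dest: antisymD)
    then show ?thesis
      unfolding lex_pos_def using i j 2 nz r(1) by (intro exI[of _ j]) (auto dest: transD)
  next
    case 3
    then have "y i = 0" using j(2)[of i] r(2) by (auto dest: antisymD)
    then show ?thesis
      unfolding lex_pos_def using i j 3 nz r(1) by (intro exI[of _ i]) (auto dest: transD)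
  qed
qed

lemma lex_pos_total:
  assumes "x \<in> E" "x \<noteq> 0"
  shows "lex_pos x \<or> lex_pos (- x)"
proof -
  let ?S = "{i. x i \<noteq> 0}"
  have r: "refl r" "trans r" "total r" using linear_order by (simp_all add: order_on_defs)
  have max: "\<exists>i\<in>S. \<forall>j\<in>S. (j, i) \<in> r" if "finite S" "S \<noteq> {}" for S
    using that
  proof (induction S rule: finite_ne_induct)
    case (singleton i)
    then show ?case using r(1) by (auto dest: reflD)
  next
    case (insert i S)
    then obtain k where k: "k \<in> S" "\<forall>j\<in>S. (j, k) \<in> r" by blast
    have "(i, k) \<in> r \<or> (k, i) \<in> r" using r(1,3) by (metis UNIV_I reflD total_on_def)
    then show ?case
      using k r(1,2) by (metis insert_iff reflD transD)
  qed
  have "finite ?S" "?S \<noteq> {}" using assms by (auto simp: finsupp_def fun_eq_iff)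
  from max[OF this] obtain i where i: "x i \<noteq> 0" "\<And>j. x j \<noteq> 0 \<Longrightarrow> (j, i) \<in> r" by auto
  then have "0 < x i \<or> 0 < - x i" by auto
  with i(2) show ?thesis unfolding lex_pos_def by auto
qed

lemma lex_pos_scale: "\<lbrakk>lex_pos x; 0 < c\<rbrakk> \<Longrightarrow> lex_pos (c *\<^sub>V x)"
  unfolding lex_pos_def by (auto intro: ordered_division_ring_mult_pos)

lemma pos_zero: "\<not> pos P 0"
  using pos0_zero by (simp add: pos_def lex_pos_def)

lemma pos_add:
  assumes "pos P x" "pos P y" "x \<in> E" "y \<in> E"
  shows "pos P (x + y)"
proof -
  \<comment> \<open>Write \<open>x\<close> as \<open>(x + y) + (- y)\<close>: one summand is
    strictly positive at \<open>P\<close>, and \<open>- y\<close> is not.\<close>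
  have *: "pos0 P (x + y)" if "pos0 P x" "pos P y" "x \<in> E" "y \<in> E" for x y
    using that pos0_add[of P "x + y" "- y"] pos0_asym[of P y] by (auto simp: pos_def E_closed)
  show ?thesis
  proof (cases "pos0 P x \<or> pos0 P y")
    case True
    then show ?thesis using *[of x y] *[of y x] assms by (auto simp: pos_def add.commute)
  next
    case False
    with assms have "\<not> pos0 P (- x)" "\<not> pos0 P (- y)" "lex_pos x" "lex_pos y"
      by (auto simp: pos_def)
    moreover from this have "\<not> pos0 P (- x + - y)"
      using pos0_add[of P "- x" "- y"] assms(3,4) by (auto simp: E_closed)
    ultimately show ?thesis by (simp add: pos_def lex_pos_add)
  qed
qed

lemma pos_scale:
  assumes "pos P x" "x \<in> E" "0 < c"
  shows "pos P (c *\<^sub>V x)"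
proof -
  have "- (c *\<^sub>V x) = c *\<^sub>V (- x)" by (simp add: fun_eq_iff)
  then show ?thesis
    using assms pos0_scale[of x c P] pos0_scale[of "- x" c P] lex_pos_scale[of x c]
    by (auto simp: pos_def E_closed)
qed

lemma pos_total: "\<lbrakk>x \<in> E; x \<noteq> 0\<rbrakk> \<Longrightarrow> pos P x \<or> pos P (- x)"
  using lex_pos_total by (auto simp: pos_def)

definition leq :: "'l set \<Rightarrow> ('i \<Rightarrow> 'k) \<Rightarrow> ('i \<Rightarrow> 'k) \<Rightarrow> bool"
  where "leq P x y \<longleftrightarrow> x = y \<or> pos P (y - x)"

lemma leq_refl: "leq P x x"
  by (simp add: leq_def)

lemma leq_trans: "\<lbrakk>leq P x y; leq P y z; x \<in> E; y \<in> E; z \<in> E\<rbrakk> \<Longrightarrow> leq P x z"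
  using pos_add[of P "y - x" "z - y"] by (auto simp: leq_def E_closed)

lemma leq_antisym: "\<lbrakk>leq P x y; leq P y x; x \<in> E; y \<in> E\<rbrakk> \<Longrightarrow> x = y"
  using pos_add[of P "y - x" "x - y"] pos_zero by (auto simp: leq_def E_closed)

lemma leq_total: "\<lbrakk>x \<in> E; y \<in> E\<rbrakk> \<Longrightarrow> leq P x y \<or> leq P y x"
  using pos_total[of "y - x" P] by (auto simp: leq_def E_closed)

lemma leq_add_iff: "leq P (x + z) (y + z) \<longleftrightarrow> leq P x y"
  by (simp add: leq_def)

lemma leq_scale:
  assumes "leq P x y" "x \<in> E" "y \<in> E" "0 \<le> c"
  shows "leq P (c *\<^sub>V x) (c *\<^sub>V y)"
proof (cases "x = y \<or> c = 0")
  case False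
  then have "pos P (c *\<^sub>V (y - x))" using assms by (intro pos_scale) (auto simp: leq_def E_closed)
  moreover have "c *\<^sub>V (y - x) = c *\<^sub>V y - c *\<^sub>V x" by (simp add: fun_eq_iff right_diff_distrib)
  ultimately show ?thesis by (simp add: leq_def)
qed (auto simp: leq_def fun_eq_iff)

lemma leq_neg: "leq P (- y) (- x) \<longleftrightarrow> leq P x y"
  by (auto simp: leq_def)

section \<open>Maxima and minima of constant functions\<close>

definition mx :: "'l set \<Rightarrow> ('i \<Rightarrow> 'k) \<Rightarrow> ('i \<Rightarrow> 'k) \<Rightarrow> 'i \<Rightarrow> 'k"
  where "mx P x y = (if leq P x y then y else x)"

definition mn :: "'l set \<Rightarrow> ('i \<Rightarrow> 'k) \<Rightarrow> ('i \<Rightarrow> 'k) \<Rightarrow> 'i \<Rightarrow> 'k"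
  where "mn P x y = (if leq P x y then x else y)"

lemma mx_upper: "x \<in> E \<Longrightarrow> y \<in> E \<Longrightarrow> leq P x (mx P x y)" "x \<in> E \<Longrightarrow> y \<in> E \<Longrightarrow> leq P y (mx P x y)"
  using leq_total leq_refl by (auto simp: mx_def)

lemma mx_least: "leq P x z \<Longrightarrow> leq P y z \<Longrightarrow> leq P (mx P x y) z"
  by (simp add: mx_def)

lemma mn_greatest: "leq P z x \<Longrightarrow> leq P z y \<Longrightarrow> leq P z (mn P x y)"
  by (simp add: mn_def)

lemma mn_lower: "x \<in> E \<Longrightarrow> y \<in> E \<Longrightarrow> leq P (mn P x y) x" "x \<in> E \<Longrightarrow> y \<in> E \<Longrightarrow> leq P (mn P x y) y"
  using leq_total leq_refl by (auto simp: mn_def)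

text \<open>This is the sublattice generated by the constants in the product of the chains
  \<open>leq P\<close>. It is already closed under sums and scalars, since these distribute over
  maxima and minima. Having no generation rule for sums matters for
  \<open>represents_exists\<close>: maxima and minima correspond to joins and meets in
  \<open>L\<close>, whereas the value of a sum is not determined by those of its summands.\<close>

inductive_set M :: "('l set \<Rightarrow> 'i \<Rightarrow> 'k) set" where
  const: "x \<in> E \<Longrightarrow> (\<lambda>P. x) \<in> M"
| mx: "f \<in> M \<Longrightarrow> g \<in> M \<Longrightarrow> (\<lambda>P. mx P (f P) (g P)) \<in> M"
| mn: "f \<in> M \<Longrightarrow> g \<in> M \<Longrightarrow> (\<lambda>P. mn P (f P) (g P)) \<in> M"

lemma M_in_E: "f \<in> M \<Longrightarrow> f P \<in> E"
  by (induction rule: M.induct) (auto simp: mx_def mn_def)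

lemma mx_add: "mx P x y + z = mx P (x + z) (y + z)" "z + mx P x y = mx P (z + x) (z + y)"
  and mn_add: "mn P x y + z = mn P (x + z) (y + z)" "z + mn P x y = mn P (z + x) (z + y)"
  using leq_add_iff[of P x z y] by (auto simp: mx_def mn_def add.commute)

lemma M_add:
  assumes "f \<in> M" "g \<in> M"
  shows "(\<lambda>P. f P + g P) \<in> M"
  using assms(1)
proof (induction rule: M.induct)
  case (const x)
  show ?case
    using assms(2)
  proof (induction rule: M.induct)
    case (const y)
    with \<open>x \<in> E\<close> show ?case by (intro M.const E_closed)
  qed (simp_all only: mx_add mn_add M.intros)
qed (simp_all only: mx_add mn_add M.intros)

lemma mx_scale: "\<lbrakk>x \<in> E; y \<in> E; 0 \<le> c\<rbrakk> \<Longrightarrow> c *\<^sub>V mx P x y = mx P (c *\<^sub>V x) (c *\<^sub>V y)"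
  and mn_scale: "\<lbrakk>x \<in> E; y \<in> E; 0 \<le> c\<rbrakk> \<Longrightarrow> c *\<^sub>V mn P x y = mn P (c *\<^sub>V x) (c *\<^sub>V y)"
  using leq_total[of x y P] leq_scale[of P x y c] leq_scale[of P y x c]
    leq_antisym[of P "c *\<^sub>V x" "c *\<^sub>V y"]
  by (auto simp: mx_def mn_def E_closed)

lemma mx_neg: "\<lbrakk>x \<in> E; y \<in> E\<rbrakk> \<Longrightarrow> - mx P x y = mn P (- x) (- y)"
  and mn_neg: "\<lbrakk>x \<in> E; y \<in> E\<rbrakk> \<Longrightarrow> - mn P x y = mx P (- x) (- y)"
  using leq_total[of x y P] leq_antisym[of P x y] by (auto simp: mx_def mn_def leq_neg)

lemma M_neg: "f \<in> M \<Longrightarrow> (\<lambda>P. - f P) \<in> M"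
proof (induction rule: M.induct)
  case (const x)
  then show ?case by (intro M.const E_closed)
qed (simp_all only: mx_neg mn_neg M_in_E M.intros)

lemma M_scale: "f \<in> M \<Longrightarrow> (\<lambda>P. c *\<^sub>V f P) \<in> M"
proof -
  have nonneg: "(\<lambda>P. c *\<^sub>V f P) \<in> M" if "f \<in> M" "0 \<le> c" for f c
    using that
  proof (induction rule: M.induct)
    case (const x)
    then show ?case by (intro M.const E_closed)
  qed (simp_all add: mx_scale mn_scale M_in_E M.intros)
  assume f: "f \<in> M"
  show ?thesis
  proof (cases "0 \<le> c")
    case False
    \<comment> \<open>A negative scalar exchanges maxima and minima, so it is split into a positive
      scalar followed by negation.\<close>
    have "(\<lambda>P. - ((- c) *\<^sub>V f P)) \<in> M" using False f by (intro M_neg nonneg) auto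
    moreover have "- ((- c) *\<^sub>V f P) = c *\<^sub>V f P" for P by (simp add: fun_eq_iff)
    ultimately show ?thesis by simp
  qed (simp add: nonneg f)
qed

definition nonneg :: "('l set \<Rightarrow> 'i \<Rightarrow> 'k) \<Rightarrow> bool"
  where "nonneg f \<longleftrightarrow> f \<in> M \<and> (\<forall>P. leq P 0 (f P))"

section \<open>The vector lattice on the image of \<open>J\<close>\<close>

definition D :: "'v \<Rightarrow> 'l set \<Rightarrow> 'i \<Rightarrow> 'k"
  where "D = inv_into UNIV J"

lemma D_J [simp]: "D (J f) = f"
  by (simp add: D_def inj)

definition F :: "('k, 'v) ordered_module"
  where "F = \<lparr>carrier = J ` M, mult = (\<lambda>x y. x), one = J (\<lambda>P. 0), zero = J (\<lambda>P. 0),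
    add = (\<lambda>x y. J (\<lambda>P. D x P + D y P)), smult = (\<lambda>c x. J (\<lambda>P. c *\<^sub>V D x P)),
    vle = (\<lambda>x y. \<forall>P. leq P (D x P) (D y P))\<rparr>"

lemma F_simps [simp]:
  "carrier F = J ` M" "\<zero>\<^bsub>F\<^esub> = J (\<lambda>P. 0)" "J f \<oplus>\<^bsub>F\<^esub> J g = J (\<lambda>P. f P + g P)"
  "c \<odot>\<^bsub>F\<^esub> J f = J (\<lambda>P. c *\<^sub>V f P)" "J f \<preceq>\<^bsub>F\<^esub> J g \<longleftrightarrow> (\<forall>P. leq P (f P) (g P))"
  by (simp_all add: F_def)

lemma J_eq_iff: "J f = J g \<longleftrightarrow> f = g"
  using inj by (simp add: inj_eq)

lemma J_mem_iff [simp]: "J f \<in> J ` M \<longleftrightarrow> f \<in> M"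
  by (rule inj_image_mem_iff[OF inj])

lemma lattice_F: "Lattice.lattice (vorder F)"
proof (rule lattice_recordI)
  fix x y assume "x \<in> carrier (vorder F)" "y \<in> carrier (vorder F)"
  then obtain f g where fg: "x = J f" "y = J g" "f \<in> M" "g \<in> M" by (auto simp: vorder_def)
  show "x = y" if "le (vorder F) x y" "le (vorder F) y x"
  proof -
    have "f P = g P" for P using that fg by (intro leq_antisym[of P] M_in_E) (auto simp: vorder_def)
    then have "f = g" ..
    then show ?thesis using fg by simp
  qed
  show "\<exists>s\<in>carrier (vorder F). le (vorder F) x s \<and> le (vorder F) y s \<and>
      (\<forall>z\<in>carrier (vorder F). le (vorder F) x z \<longrightarrow> le (vorder F) y z \<longrightarrow> le (vorder F) s z)"
    using fg by (intro bexI[of _ "J (\<lambda>P. mx P (f P) (g P))"])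
      (auto simp: vorder_def mx_upper M_in_E M.mx mx_least)
  show "\<exists>s\<in>carrier (vorder F). le (vorder F) s x \<and> le (vorder F) s y \<and>
      (\<forall>z\<in>carrier (vorder F). le (vorder F) z x \<longrightarrow> le (vorder F) z y \<longrightarrow> le (vorder F) z s)"
    using fg by (intro bexI[of _ "J (\<lambda>P. mn P (f P) (g P))"])
      (auto simp: vorder_def mn_lower M_in_E M.mn mn_greatest)
next
  fix x y z assume "x \<in> carrier (vorder F)" "y \<in> carrier (vorder F)" "z \<in> carrier (vorder F)"
    "le (vorder F) x y" "le (vorder F) y z"
  then obtain f g k where fgk: "x = J f" "y = J g" "z = J k" "f \<in> M" "g \<in> M" "k \<in> M"
      "\<And>P. leq P (f P) (g P)" "\<And>P. leq P (g P) (k P)"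
    by (auto simp: vorder_def)
  then have "leq P (f P) (k P)" for P by (blast intro: leq_trans[of P "f P" "g P"] M_in_E)
  with fgk show "le (vorder F) x z" by (simp add: vorder_def)
qed (auto simp: vorder_def leq_refl)

lemma abelian_group_F: "abelian_group F"
proof (rule abelian_groupI)
  fix x assume "x \<in> carrier F"
  then obtain f where f: "x = J f" "f \<in> M" by auto
  then show "\<exists>y\<in>carrier F. y \<oplus>\<^bsub>F\<^esub> x = \<zero>\<^bsub>F\<^esub>"
    by (intro bexI[of _ "J (\<lambda>P. - f P)"]) (auto simp: M_neg)
qed (auto simp: M_add E_closed ac_simps intro: M.const)

lemma vector_lattice_F: "vector_lattice F"
proof (intro vector_lattice.intro abelian_group_F lattice_F vector_lattice_axioms.intro)
  fix x y and c :: 'k assume "x \<in> carrier F" "y \<in> carrier F"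
  then show "c \<odot>\<^bsub>F\<^esub> (x \<oplus>\<^bsub>F\<^esub> y) = c \<odot>\<^bsub>F\<^esub> x \<oplus>\<^bsub>F\<^esub> c \<odot>\<^bsub>F\<^esub> y"
    by (auto simp: J_eq_iff fun_eq_iff distrib_left)
next
  fix x and c :: 'k assume "x \<in> carrier F" "0 \<le> c" "\<zero>\<^bsub>F\<^esub> \<preceq>\<^bsub>F\<^esub> x"
  moreover have "c *\<^sub>V 0 = (0 :: 'i \<Rightarrow> 'k)" by (simp add: fun_eq_iff)
  ultimately show "\<zero>\<^bsub>F\<^esub> \<preceq>\<^bsub>F\<^esub> c \<odot>\<^bsub>F\<^esub> x"
    using leq_scale[of _ 0 _ c] by (force simp: E_closed M_in_E)
qed (auto simp: J_eq_iff fun_eq_iff M_scale leq_add_iff distrib_right mult.assoc)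

interpretation vl: vector_lattice F by (rule vector_lattice_F)

lemma neg_F: "f \<in> M \<Longrightarrow> \<ominus>\<^bsub>F\<^esub> J f = J (\<lambda>P. - f P)"
  by (rule vl.minus_equality) (auto simp: M_neg)

lemma vabs_F:
  assumes "f \<in> M"
  shows "vabs F (J f) = J (\<lambda>P. mx P (f P) (- f P))"
  unfolding vabs_def neg_F[OF assms]
  using assms M_neg[OF assms]
  by (intro vl.ord.join_eqI)
    (auto simp: vorder_def M.mx mx_upper M_in_E E_closed mx_least)

section \<open>The lattice of principal ideals\<close>

definition ideal :: "('l set \<Rightarrow> 'i \<Rightarrow> 'k) \<Rightarrow> 'v set"
  where "ideal f = principal_ideal F (J f)"

lemma mem_ideal_iff:
  "x \<in> ideal g \<longleftrightarrow> (\<exists>f\<in>M. x = J f \<and> (\<exists>c. \<forall>P. leq P (mx P (f P) (- f P)) (c *\<^sub>V g P)))"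
  by (auto simp: ideal_def principal_ideal_def vabs_F J_eq_iff) blast

lemma scale_mono_scalar:
  assumes "leq P 0 x" "x \<in> E" "c \<le> d"
  shows "leq P (c *\<^sub>V x) (d *\<^sub>V x)"
proof -
  have "leq P ((d - c) *\<^sub>V 0) ((d - c) *\<^sub>V x)" using assms by (intro leq_scale) (auto simp: E_closed)
  then have "leq P ((d - c) *\<^sub>V 0 + c *\<^sub>V x) ((d - c) *\<^sub>V x + c *\<^sub>V x)" by (simp only: leq_add_iff)
  moreover have "(d - c) *\<^sub>V 0 + c *\<^sub>V x = c *\<^sub>V x" "(d - c) *\<^sub>V x + c *\<^sub>V x = d *\<^sub>V x"
    by (simp_all add: fun_eq_iff left_diff_distrib)
  ultimately show ?thesis by simp
qed

text \<open>One scalar has to work at all points simultaneously. It can be taken strictly positive,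
  so that multiplying by it changes no value of \<phi>; \<open>represents_mono\<close> relies on
  this.\<close>

lemma ideal_subset_iff:
  assumes f: "nonneg f" and g: "nonneg g"
  shows "ideal f \<subseteq> ideal g \<longleftrightarrow> (\<exists>c>0. \<forall>P. leq P (f P) (c *\<^sub>V g P))"
proof
  have fM: "f \<in> M" "leq P 0 (f P)" "f P \<in> E" and gM: "g \<in> M" "leq P 0 (g P)" "g P \<in> E" for P
    using f g by (auto simp: nonneg_def M_in_E)
  have one: "0 < (1 :: 'k)" by (rule ordered_division_ring_zero_less_one)
  {
    have abs: "mx P (f P) (- f P) = f P" for P
    proof -
      have "leq P (- f P) 0" using leq_neg[of P "f P" 0] fM(2) by (metis leq_neg minus_zero)
      then have "leq P (- f P) (f P)" using fM by (blast intro: leq_trans E_closed)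
      then show ?thesis unfolding mx_def using leq_antisym fM(3) E_closed(4) by metis
    qed
    have "J f \<in> ideal f"
      unfolding mem_ideal_iff using fM(1) leq_refl
      by (intro bexI[of _ f] conjI refl exI[of _ 1]) (auto simp: abs scale_def)
    moreover assume "ideal f \<subseteq> ideal g"
    ultimately have "J f \<in> ideal g" by blast
    then obtain c where c: "\<And>P. leq P (f P) (c *\<^sub>V g P)"
      unfolding mem_ideal_iff J_eq_iff by (auto simp: abs)
    \<comment> \<open>Enlarging the scalar is allowed because \<open>g\<close> is
      nonnegative.\<close>
    have "leq P (f P) (max c 1 *\<^sub>V g P)" for P
      using c scale_mono_scalar[OF gM(2,3), of c "max c 1"] fM(3) gM(3)
      by (blast intro: leq_trans E_closed max.cobounded1)
    then show "\<exists>c>0. \<forall>P. leq P (f P) (c *\<^sub>V g P)"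
      using one by (intro exI[of _ "max c 1"]) (auto simp: less_max_iff_disj)
  next
    assume "\<exists>c>0. \<forall>P. leq P (f P) (c *\<^sub>V g P)"
    then obtain c where c: "0 < c" "\<And>P. leq P (f P) (c *\<^sub>V g P)" by blast
    show "ideal f \<subseteq> ideal g"
    proof
      fix x assume "x \<in> ideal f"
      then obtain h d where h: "h \<in> M" "x = J h" "\<And>P. leq P (mx P (h P) (- h P)) (d *\<^sub>V f P)"
        unfolding mem_ideal_iff by blast
      \<comment> \<open>The scalar \<open>d\<close> may be negative; replacing it by
        \<open>max d 1\<close> permits multiplying the bound on \<open>f\<close> by it, from the
        left.\<close>
      have "leq P (mx P (h P) (- h P)) ((max d 1 * c) *\<^sub>V g P)" for P
      proof -
        have "mx P (h P) (- h P) \<in> E" using M_in_E[OF h(1)] by (simp add: mx_def E_closed)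
        moreover have "leq P (d *\<^sub>V f P) (max d 1 *\<^sub>V f P)" by (intro scale_mono_scalar fM) simp
        moreover have "leq P (max d 1 *\<^sub>V f P) (max d 1 *\<^sub>V c *\<^sub>V g P)"
          using one by (intro leq_scale c fM E_closed gM) (auto simp: le_max_iff_disj less_imp_le)
        ultimately show ?thesis
          using h(3)[of P] fM(3) gM(3) unfolding scale_scale[symmetric]
          by (meson leq_trans E_closed(3))
      qed
      with h(1,2) show "x \<in> ideal g" unfolding mem_ideal_iff by blast
    qed
  }
qed

lemma carrier_Idc: "carrier (Idc F) = {ideal f |f. nonneg f}"
  unfolding Idc_def ideal_def nonneg_def by auto

lemma nonneg_mx: "\<lbrakk>nonneg f; nonneg g\<rbrakk> \<Longrightarrow> nonneg (\<lambda>P. mx P (f P) (g P))"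
  and nonneg_mn: "\<lbrakk>nonneg f; nonneg g\<rbrakk> \<Longrightarrow> nonneg (\<lambda>P. mn P (f P) (g P))"
  by (simp_all add: nonneg_def M.mx M.mn) (simp_all add: mx_def mn_def)

lemma ideal_mx:
  assumes f: "nonneg f" and g: "nonneg g"
  defines "s \<equiv> \<lambda>P. mx P (f P) (g P)"
  shows "ideal f \<subseteq> ideal s" "ideal g \<subseteq> ideal s"
    "\<lbrakk>nonneg k; ideal f \<subseteq> ideal k; ideal g \<subseteq> ideal k\<rbrakk> \<Longrightarrow> ideal s \<subseteq> ideal k"
proof -
  have s: "nonneg s" unfolding s_def using f g by (rule nonneg_mx)
  have E: "f P \<in> E" "g P \<in> E" for P using f g by (auto simp: nonneg_def M_in_E)
  have one: "1 *\<^sub>V x = x" for x :: "'i \<Rightarrow> 'k" by (simp add: fun_eq_iff)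
  show "ideal f \<subseteq> ideal s" "ideal g \<subseteq> ideal s"
    unfolding ideal_subset_iff[OF f s] ideal_subset_iff[OF g s]
    using E mx_upper ordered_division_ring_zero_less_one[where 'k = 'k]
    by (auto intro!: exI[of _ 1] simp: one s_def)
  assume k: "nonneg k" and "ideal f \<subseteq> ideal k" "ideal g \<subseteq> ideal k"
  then obtain c d where c: "0 < c" "\<And>P. leq P (f P) (c *\<^sub>V k P)" and d: "0 < d" "\<And>P. leq P (g P) (d *\<^sub>V k P)"
    unfolding ideal_subset_iff[OF f k] ideal_subset_iff[OF g k] by blast
  have kE: "k P \<in> E" "leq P 0 (k P)" for P using k by (auto simp: nonneg_def M_in_E)
  have "leq P (s P) (max c d *\<^sub>V k P)" for P
  proof -
    have "leq P (f P) (max c d *\<^sub>V k P)"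
      by (rule leq_trans[OF c(2) scale_mono_scalar[OF kE(2,1)]]) (simp_all add: E E_closed kE)
    moreover have "leq P (g P) (max c d *\<^sub>V k P)"
      by (rule leq_trans[OF d(2) scale_mono_scalar[OF kE(2,1)]]) (simp_all add: E E_closed kE)
    ultimately show ?thesis unfolding s_def by (rule mx_least)
  qed
  then show "ideal s \<subseteq> ideal k"
    unfolding ideal_subset_iff[OF s k] using c(1) by (intro exI[of _ "max c d"]) (auto simp: less_max_iff_disj)
qed

lemma ideal_mn:
  assumes f: "nonneg f" and g: "nonneg g"
  defines "s \<equiv> \<lambda>P. mn P (f P) (g P)"
  shows "ideal s \<subseteq> ideal f" "ideal s \<subseteq> ideal g"
    "\<lbrakk>nonneg k; ideal k \<subseteq> ideal f; ideal k \<subseteq> ideal g\<rbrakk> \<Longrightarrow> ideal k \<subseteq> ideal s"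
proof -
  have s: "nonneg s" unfolding s_def using f g by (rule nonneg_mn)
  have E: "f P \<in> E" "g P \<in> E" "leq P 0 (f P)" "leq P 0 (g P)" for P using f g by (auto simp: nonneg_def M_in_E)
  have one: "1 *\<^sub>V x = x" for x :: "'i \<Rightarrow> 'k" by (simp add: fun_eq_iff)
  show "ideal s \<subseteq> ideal f" "ideal s \<subseteq> ideal g"
    unfolding ideal_subset_iff[OF s f] ideal_subset_iff[OF s g]
    using E mn_lower ordered_division_ring_zero_less_one[where 'k = 'k]
    by (auto intro!: exI[of _ 1] simp: one s_def)
  assume k: "nonneg k" and "ideal k \<subseteq> ideal f" "ideal k \<subseteq> ideal g"
  then obtain c d where c: "0 < c" "\<And>P. leq P (k P) (c *\<^sub>V f P)" and d: "0 < d" "\<And>P. leq P (k P) (d *\<^sub>V g P)"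
    unfolding ideal_subset_iff[OF k f] ideal_subset_iff[OF k g] by blast
  have kE: "k P \<in> E" for P using k by (auto simp: nonneg_def M_in_E)
  have "leq P (k P) (max c d *\<^sub>V s P)" for P
  proof -
    have "leq P (k P) (max c d *\<^sub>V f P)"
      by (rule leq_trans[OF c(2) scale_mono_scalar[OF E(3,1)]]) (simp_all add: E E_closed kE)
    moreover have "leq P (k P) (max c d *\<^sub>V g P)"
      by (rule leq_trans[OF d(2) scale_mono_scalar[OF E(4,2)]]) (simp_all add: E E_closed kE)
    ultimately show ?thesis unfolding s_def mn_def by simp
  qed
  then show "ideal k \<subseteq> ideal s"
    unfolding ideal_subset_iff[OF k s] using c(1) by (intro exI[of _ "max c d"]) (auto simp: less_max_iff_disj)
qed

lemma lattice_Idc: "Lattice.lattice (Idc F)"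
proof (rule lattice_recordI)
  fix X Y assume "X \<in> carrier (Idc F)" "Y \<in> carrier (Idc F)"
  then obtain f g where fg: "X = ideal f" "Y = ideal g" "nonneg f" "nonneg g"
    unfolding carrier_Idc by blast
  have le: "le (Idc F) = (\<subseteq>)" by (simp add: Idc_def)
  show "\<exists>s\<in>carrier (Idc F). le (Idc F) X s \<and> le (Idc F) Y s \<and>
      (\<forall>z\<in>carrier (Idc F). le (Idc F) X z \<longrightarrow> le (Idc F) Y z \<longrightarrow> le (Idc F) s z)"
    unfolding carrier_Idc le fg(1,2)
  proof (intro bexI[of _ "ideal (\<lambda>P. mx P (f P) (g P))"] conjI ballI impI ideal_mx(1,2)[OF fg(3,4)])
    show "ideal (\<lambda>P. mx P (f P) (g P)) \<in> {ideal f |f. nonneg f}" using nonneg_mx fg(3,4) by blast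
  qed (use ideal_mx(3)[OF fg(3,4)] in blast)
  show "\<exists>s\<in>carrier (Idc F). le (Idc F) s X \<and> le (Idc F) s Y \<and>
      (\<forall>z\<in>carrier (Idc F). le (Idc F) z X \<longrightarrow> le (Idc F) z Y \<longrightarrow> le (Idc F) z s)"
    unfolding carrier_Idc le fg(1,2)
  proof (intro bexI[of _ "ideal (\<lambda>P. mn P (f P) (g P))"] conjI ballI impI ideal_mn(1,2)[OF fg(3,4)])
    show "ideal (\<lambda>P. mn P (f P) (g P)) \<in> {ideal f |f. nonneg f}" using nonneg_mn fg(3,4) by blast
  qed (use ideal_mn(3)[OF fg(3,4)] in blast)
qed (auto simp: Idc_def)

interpretation idc: Lattice.lattice "Idc F" by (rule lattice_Idc)

lemma join_Idc:
  assumes "nonneg f" "nonneg g"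
  shows "ideal f \<squnion>\<^bsub>Idc F\<^esub> ideal g = ideal (\<lambda>P. mx P (f P) (g P))"
proof (rule idc.join_eqI)
  fix z assume "z \<in> carrier (Idc F)" "le (Idc F) (ideal f) z" "le (Idc F) (ideal g) z"
  then show "le (Idc F) (ideal (\<lambda>P. mx P (f P) (g P))) z"
    using ideal_mx(3)[OF assms] unfolding carrier_Idc by (auto simp: Idc_def)
qed (use assms nonneg_mx ideal_mx(1,2)[OF assms] in \<open>auto simp: carrier_Idc, auto simp: Idc_def\<close>)

lemma meet_Idc:
  assumes "nonneg f" "nonneg g"
  shows "ideal f \<sqinter>\<^bsub>Idc F\<^esub> ideal g = ideal (\<lambda>P. mn P (f P) (g P))"
proof (rule idc.meet_eqI)
  fix z assume "z \<in> carrier (Idc F)" "le (Idc F) z (ideal f)" "le (Idc F) z (ideal g)"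
  then show "le (Idc F) z (ideal (\<lambda>P. mn P (f P) (g P)))"
    using ideal_mn(3)[OF assms] unfolding carrier_Idc by (auto simp: Idc_def)
qed (use assms nonneg_mn ideal_mn(1,2)[OF assms] in \<open>auto simp: carrier_Idc, auto simp: Idc_def\<close>)

section \<open>The homomorphism onto \<open>L\<close>\<close>

lemma pos0_mono: "\<lbrakk>pos0 P x; leq P x y; x \<in> E; y \<in> E\<rbrakk> \<Longrightarrow> pos0 P y"
  using pos0_add[of P "x - y" y] pos0_asym[of P "y - x"] by (auto simp: leq_def pos_def E_closed)

lemma pos0_mx: "\<lbrakk>x \<in> E; y \<in> E\<rbrakk> \<Longrightarrow> pos0 P (mx P x y) \<longleftrightarrow> pos0 P x \<or> pos0 P y"
  and pos0_mn: "\<lbrakk>x \<in> E; y \<in> E\<rbrakk> \<Longrightarrow> pos0 P (mn P x y) \<longleftrightarrow> pos0 P x \<and> pos0 P y"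
  using leq_total[of x y P] pos0_mono[of P x y] pos0_mono[of P y x] by (auto simp: mx_def mn_def)

text \<open>In the language of Stone duality, \<open>f\<close> is strictly positive exactly on the
  basic open set of \<open>l\<close>. Strictness refers to the preordering \<open>pos0\<close>,
  before ties are broken, as only this one is controlled by \<phi>.\<close>

definition represents :: "'l \<Rightarrow> ('l set \<Rightarrow> 'i \<Rightarrow> 'k) \<Rightarrow> bool"
  where "represents l f \<longleftrightarrow> (\<forall>P. proper_prime P \<longrightarrow> (l \<in> P \<longleftrightarrow> pos0 P (f P)))"

lemma represents_const: "represents (\<phi> x) (\<lambda>P. x)"
  by (simp add: represents_def pos0_def)

lemma represents_mx: "\<lbrakk>represents l f; represents m g; f \<in> M; g \<in> M\<rbrakk> \<Longrightarrow>
    represents (l \<curlyvee> m) (\<lambda>P. mx P (f P) (g P))"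
  by (auto simp: represents_def pos0_mx M_in_E proper_prime_def prime_filter_def)

lemma represents_mn: "\<lbrakk>represents l f; represents m g; f \<in> M; g \<in> M\<rbrakk> \<Longrightarrow>
    represents (l \<curlywedge> m) (\<lambda>P. mn P (f P) (g P))"
  by (auto simp: represents_def pos0_mn M_in_E proper_prime_def prime_filter_def)

lemma represents_exists: "f \<in> M \<Longrightarrow> \<exists>l. represents l f"
  by (induction rule: M.induct) (blast intro: represents_const represents_mx represents_mn)+

text \<open>A prime filter containing \<open>l\<close> but not \<open>m\<close> would be a point
  where \<open>f\<close> is strictly positive and \<open>g\<close> is not, although a positive
  multiple of \<open>g\<close> dominates \<open>f\<close>.\<close>

lemma represents_mono:
  assumes "represents l f" "represents m g" "nonneg f" "nonneg g" "ideal f \<subseteq> ideal g"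
  shows "l \<le> m"
proof (rule ccontr)
  assume "\<not> l \<le> m"
  then obtain P where P: "prime_filter P" "l \<in> P" "m \<notin> P" using prime_filter_exists by blast
  then have "proper_prime P" using prime_filter_mono[of P bot m] by (auto simp: proper_prime_def)
  then have "pos0 P (f P)" "\<not> pos0 P (g P)" using P assms(1,2) by (auto simp: represents_def)
  moreover obtain c where c: "0 < c" "leq P (f P) (c *\<^sub>V g P)"
    using assms(5) unfolding ideal_subset_iff[OF assms(3,4)] by blast
  moreover have "f P \<in> E" "g P \<in> E" using assms(3,4) by (auto simp: nonneg_def M_in_E)
  ultimately show False using pos0_mono[OF _ c(2)] pos0_scale by (auto simp: E_closed)
qed

definition h :: "'v set \<Rightarrow> 'l"
  where "h X = (SOME l. \<exists>f. nonneg f \<and> X = ideal f \<and> represents l f)"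

text \<open>Equal ideals contain each other, so \<open>represents_mono\<close> in both directions
  makes the choice in \<open>h\<close> immaterial.\<close>

lemma h_ideal:
  assumes "nonneg f" "represents l f"
  shows "h (ideal f) = l"
proof -
  have "\<exists>g. nonneg g \<and> ideal f = ideal g \<and> represents (h (ideal f)) g"
    unfolding h_def by (rule someI[of _ l]) (use assms in blast)
  then obtain g where g: "nonneg g" "ideal f = ideal g" "represents (h (ideal f)) g" by blast
  show ?thesis
    using represents_mono[OF assms(2) g(3) assms(1) g(1)] represents_mono[OF g(3) assms(2) g(1) assms(1)] g(2)
    by simp
qed

lemma lattice_hom_h: "lattice_hom (Idc F) h"
  unfolding lattice_hom_def
proof (intro conjI lattice_Idc ballI)
  fix X Y assume "X \<in> carrier (Idc F)" "Y \<in> carrier (Idc F)"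
  then obtain f g where fg: "X = ideal f" "Y = ideal g" "nonneg f" "nonneg g"
    unfolding carrier_Idc by blast
  then have M: "f \<in> M" "g \<in> M" by (auto simp: nonneg_def)
  then obtain l m where lm: "represents l f" "represents m g" using represents_exists by blast
  have h: "h (ideal f) = l" "h (ideal g) = m" using h_ideal fg(3,4) lm by auto
  show "h (X \<squnion>\<^bsub>Idc F\<^esub> Y) = h X \<curlyvee> h Y"
    unfolding fg(1,2) join_Idc[OF fg(3,4)] h by (intro h_ideal nonneg_mx represents_mx fg lm M)
  show "h (X \<sqinter>\<^bsub>Idc F\<^esub> Y) = h X \<curlywedge> h Y"
    unfolding fg(1,2) meet_Idc[OF fg(3,4)] h by (intro h_ideal nonneg_mn represents_mn fg lm M)
qed

lemma range_h: "\<phi> ` E \<subseteq> h ` carrier (Idc F)"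
proof
  fix l assume "l \<in> \<phi> ` E"
  then obtain x where x: "l = \<phi> x" "x \<in> E" by blast
  \<comment> \<open>The positive part of the constant \<open>x\<close> represents
    \<open>\<phi> x \<curlyvee> \<phi> 0\<close>, and \<open>\<phi> 0\<close> is
    \<open>bot\<close>.\<close>
  let ?f = "\<lambda>P. mx P x 0"
  have "nonneg ?f"
    using x(2) M.mx[OF M.const M.const, of x 0] mx_upper(2)[of x 0] by (simp add: nonneg_def E_closed)
  moreover have "represents l ?f"
    using represents_mx[OF represents_const represents_const M.const M.const, of x 0] x
      valued_order_zero[OF valued_order lin_subspace_finsupp] by (simp add: E_closed)
  ultimately have "h (ideal ?f) = l" "ideal ?f \<in> carrier (Idc F)"
    by (auto simp: h_ideal carrier_Idc)
  then show "l \<in> h ` carrier (Idc F)" by blast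
qed

end

text \<open>It suffices to embed the pairs of a point and a coordinate into the functions from
  \<open>'l \<times> nat\<close> to \<open>'k\<close>; composition with a left inverse of that
  embedding then embeds the functions on pairs.\<close>

lemma vl_universe_embedding:
  "\<exists>J :: ('l set \<Rightarrow> 'l \<Rightarrow> 'k) \<Rightarrow> ('k :: zero_neq_one, 'l) vl_universe. inj J"
proof -
  \<comment> \<open>Layer 0 holds the characteristic function of the set, and every other layer that
    of the singleton of the coordinate.\<close>
  define code :: "'l set \<times> 'l \<Rightarrow> 'l \<times> nat \<Rightarrow> 'k"
    where "code p q = (if snd q = 0 then of_bool (fst q \<in> fst p) else of_bool (fst q = snd p))" for p q
  have "inj code"
  proof (rule injI)
    fix p p' assume eq: "code p = code p'"
    have "x \<in> fst p \<longleftrightarrow> x \<in> fst p'" "x = snd p \<longleftrightarrow> x = snd p'" for x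
      using fun_cong[OF eq, of "(x, 0)"] fun_cong[OF eq, of "(x, 1)"]
      by (simp_all add: code_def of_bool_def split: if_splits)
    then show "p = p'" by (auto simp: prod_eq_iff)
  qed
  define J :: "('l set \<Rightarrow> 'l \<Rightarrow> 'k) \<Rightarrow> ('k, 'l) vl_universe"
    where "J f y = case_prod f (inv_into UNIV code y)" for f y
  have "J f (code (P, i)) = f P i" for f P i using \<open>inj code\<close> by (simp add: J_def)
  then have "inj J" by (metis injI ext)
  then show ?thesis by blast
qed

theorem theorem7p4:
  assumes "countable (UNIV :: 'k :: {division_ring, linordered_ring} set)"
    and "completely_normal TYPE('l :: {distrib_lattice, bounded_lattice_bot})"
    and "|UNIV :: 'l set| \<le>o cardSuc natLeq"
  shows "\<exists>(F :: ('k, ('k, 'l) vl_universe) ordered_module) (h :: ('k, 'l) vl_universe set \<Rightarrow> 'l).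
           vector_lattice F \<and> lattice_hom (Idc F) h \<and> h ` carrier (Idc F) = UNIV"
proof -
  obtain \<phi> :: "('l \<Rightarrow> 'k) \<Rightarrow> 'l"
    where \<phi>: "valued_order (finsupp UNIV) \<phi>" "\<And>l. \<phi> (unit_vec l) = l"
    using valued_order_exists[OF assms] by blast
  obtain J :: "('l set \<Rightarrow> 'l \<Rightarrow> 'k) \<Rightarrow> ('k, 'l) vl_universe" where "inj J"
    using vl_universe_embedding by blast
  \<comment> \<open>Any linear order of the basis could break the ties; the cardinal of
    \<open>'l\<close> is one.\<close>
  moreover have "linear_order |UNIV :: 'l set|"
    using card_of_well_order_on[of "UNIV :: 'l set"] by (simp add: well_order_on_def)
  ultimately interpret lattice_valued_order \<phi> "|UNIV|" J
    using \<phi>(1) by unfold_locales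
  have "unit_vec l \<in> E" for l by (auto simp: finsupp_def unit_vec_def)
  then have "h ` carrier (Idc F) = UNIV"
    using range_h \<phi>(2) by (metis UNIV_eq_I image_subset_iff)
  with vector_lattice_F lattice_hom_h show ?thesis by blast
qed

end
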